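(* For every $\varepsilon\in(0,1/2)$ there exist constants $c,C>1$ and a constant $K$ depending only on $\varepsilon$ such that for every $n\ge C$, the weighted diamond $W_n$ (with parameter $\varepsilon$) can be embedded with distortion at most $K$ into every Banach space $X$ with $\dim X\ge\exp\left(c(\log\log|W_n|)^2\right)$.
   Context: Diamond graphs $\{D_n\}_{n\ge0}$: $D_0$ consists of two vertices joined by an edge; $D_n$ is obtained from $D_{n-1}$ by replacing each edge $uv$ of $D_{n-1}$ by a quadrilateral $u,a,v,b$ with two new vertices $a,b$ and edges $ua, av, vb, bu$. Thus the vertex set of $D_{n-1}$ is contained in that of $D_n$. Weighted diamonds: fix $\varepsilon\in(0,\frac12)$. $W_n$ is the weighted graph whose vertex set is the vertex set of $D_n$ and whose edge set is the union of the edge sets of $D_0,D_1,\dots,D_n$, where each edge of $D_i$ is given weight $\left(\frac12+\varepsilon\right)^i$. $W_n$ is endowed with its (weighted) shortest path distance. $|W_n|$ is the number of vertices of $W_n$. The base of the logarithm is immaterial (it affects only the constants). The distortion of an injective map $f:X\to Y$ between metric spaces is $\sup_{x\ne y}\frac{d_Y(f(x),f(y))}{d_X(x,y)}\cdot\sup_{x\ne y}\frac{d_X(x,y)}{d_Y(f(x),f(y))}$. *)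

theory Defs
  imports
    "HOL-Analysis.Analysis"
    "Graph_Theory.Pair_Digraph"
    "Graph_Theory.Shortest_Path"
begin

section \<open>Diamond graphs\<close>

text \<open>
  \<open>New u v False\<close> and \<open>New u v True\<close> are the two vertices \<open>a\<close>, \<open>b\<close> that are created when the
  edge \<open>uv\<close> is replaced by the quadrilateral \<open>u, a, v, b\<close>.
\<close>

datatype vertex = Src | Snk | New vertex vertex bool

text \<open>
  The edges of \<open>D\<^sub>n\<close>, each of them listed exactly once, as a pair. The orientation serves only to
  name the new vertices; it is forgotten in \<open>diamond\<close>, where every edge is present as the two
  opposite arcs by which Graph_Theory represents an undirected edge.
\<close>

fun diamond_edges :: "nat \<Rightarrow> (vertex \<times> vertex) set" where
  "diamond_edges 0 = {(Src, Snk)}"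
| "diamond_edges (Suc n) =
    (\<Union>(u, v) \<in> diamond_edges n.
      let a = New u v False; b = New u v True in {(u, a), (a, v), (v, b), (b, u)})"

definition diamond :: "nat \<Rightarrow> vertex pair_pre_digraph" where
  "diamond n = \<lparr> pverts = Field (diamond_edges n),
                 parcs = diamond_edges n \<union> (diamond_edges n)\<inverse> \<rparr>"

definition weighted_diamond :: "nat \<Rightarrow> vertex pair_pre_digraph" where
  "weighted_diamond n = \<lparr> pverts = pverts (diamond n), parcs = (\<Union>i\<le>n. parcs (diamond i)) \<rparr>"

text \<open>
  The edge sets of the \<open>D\<^sub>i\<close> are pairwise disjoint (\<open>diamond_level_unique\<close> below), so that the
  exponent is the only \<open>i\<close> such that \<open>e\<close> is an edge of \<open>D\<^sub>i\<close>.
\<close>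

definition diamond_weight :: "real \<Rightarrow> vertex \<times> vertex \<Rightarrow> real" where
  "diamond_weight \<epsilon> e = (1 / 2 + \<epsilon>) ^ (LEAST i. e \<in> parcs (diamond i))"

text \<open>
  The shortest path distance \<open>wf_digraph.\<mu>\<close> takes values in \<open>ereal\<close>; here it is finite, because
  \<open>W\<^sub>n\<close> is connected (\<open>weighted_diamond_dist_finite\<close> below).
\<close>

definition weighted_diamond_dist :: "real \<Rightarrow> nat \<Rightarrow> vertex \<Rightarrow> vertex \<Rightarrow> real" where
  "weighted_diamond_dist \<epsilon> n u v =
    real_of_ereal (wf_digraph.\<mu> (with_proj (weighted_diamond n)) (diamond_weight \<epsilon>) u v)"

subsection \<open>Basic properties\<close>

lemma diamond_verts_0: "pverts (diamond 0) = {Src, Snk}"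
  by (auto simp: diamond_def Field_def)

lemma diamond_verts_Suc:
  "pverts (diamond (Suc n)) =
    pverts (diamond n) \<union> {New u v s | u v s. (u, v) \<in> diamond_edges n}"
proof -
  have "pverts (diamond (Suc n)) =
      (\<Union>(u, v) \<in> diamond_edges n. {u, v, New u v False, New u v True})"
    unfolding diamond_def diamond_edges.simps pair_pre_digraph.simps Field_def Domain_Union Range_Union
    by (simp add: Let_def case_prod_unfold) blast
  also have "\<dots> = (\<Union>(u, v) \<in> diamond_edges n. {u, v}) \<union>
      {New u v s | u v s. (u, v) \<in> diamond_edges n}"
    by (auto simp: case_prod_unfold)
  also have "(\<Union>(u, v) \<in> diamond_edges n. {u, v}) = pverts (diamond n)"
    unfolding diamond_def Field_def by force
  finally show ?thesis .
qed

primrec vertex_depth :: "vertex \<Rightarrow> nat" where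
  "vertex_depth Src = 0"
| "vertex_depth Snk = 0"
| "vertex_depth (New u v s) = Suc (max (vertex_depth u) (vertex_depth v))"

lemma diamond_edges_depth:
  "(u, v) \<in> diamond_edges n \<Longrightarrow> max (vertex_depth u) (vertex_depth v) = n \<and> u \<noteq> v"
proof (induction n arbitrary: u v)
  case (Suc n)
  then obtain x y where xy: "(x, y) \<in> diamond_edges n"
    and uv: "(u, v) \<in> {(x, New x y False), (New x y False, y), (y, New x y True), (New x y True, x)}"
    by (auto simp: Let_def)
  from Suc.IH[OF xy] have "max (vertex_depth x) (vertex_depth y) = n" by simp
  then have "vertex_depth x \<le> n" "vertex_depth y \<le> n"
    "vertex_depth (New x y s) = Suc n" for s by auto
  with uv show ?case by fastforce
qed auto

lemma diamond_level_unique: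
  assumes "e \<in> parcs (diamond i)" "e \<in> parcs (diamond j)"
  shows "i = j"
proof -
  have "max (vertex_depth (fst e)) (vertex_depth (snd e)) = k"
    if "e \<in> parcs (diamond k)" for k
    using that diamond_edges_depth[of "fst e" "snd e" k] diamond_edges_depth[of "snd e" "fst e" k]
    by (cases e) (auto simp: diamond_def max.commute)
  with assms show ?thesis by metis
qed

lemma diamond_weight_eq:
  "e \<in> parcs (diamond i) \<Longrightarrow> diamond_weight \<epsilon> e = (1 / 2 + \<epsilon>) ^ i"
  unfolding diamond_weight_def
  by (metis (mono_tags, lifting) LeastI diamond_level_unique)

lemma finite_diamond_edges: "finite (diamond_edges n)"
  by (induction n) (auto simp: Let_def)

lemma diamond_verts_mono: "i \<le> n \<Longrightarrow> pverts (diamond i) \<subseteq> pverts (diamond n)"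
  by (induction rule: dec_induct) (auto simp: diamond_verts_Suc)

lemma pair_graph_weighted_diamond: "pair_graph (weighted_diamond n)"
proof
  have verts: "u \<in> pverts (diamond n) \<and> v \<in> pverts (diamond n)"
    if "(u, v) \<in> parcs (weighted_diamond n)" for u v
  proof -
    from that obtain i where "i \<le> n" "(u, v) \<in> parcs (diamond i)"
      by (auto simp: weighted_diamond_def)
    moreover from this have "u \<in> pverts (diamond i)" "v \<in> pverts (diamond i)"
      by (auto simp: diamond_def Field_def)
    ultimately show ?thesis using diamond_verts_mono by blast
  qed
  fix e
  show "fst e \<in> pverts (weighted_diamond n)" "snd e \<in> pverts (weighted_diamond n)"
    if "e \<in> parcs (weighted_diamond n)"
    using verts[of "fst e" "snd e"] that by (simp_all add: weighted_diamond_def)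
  show "fst e \<noteq> snd e" if "e \<in> parcs (weighted_diamond n)"
    using that diamond_edges_depth[of "fst e" "snd e"] diamond_edges_depth[of "snd e" "fst e"]
    by (cases e) (auto simp: weighted_diamond_def diamond_def)
  show "finite (pverts (weighted_diamond n))" "finite (parcs (weighted_diamond n))"
    by (auto simp: weighted_diamond_def diamond_def finite_diamond_edges finite_Field)
  show "symmetric (with_proj (weighted_diamond n))"
    by (auto simp: symmetric_def weighted_diamond_def diamond_def sym_def)
qed

lemma weighted_diamond_connected:
  assumes "u \<in> pverts (weighted_diamond n)" "v \<in> pverts (weighted_diamond n)"
  shows "reachable (with_proj (weighted_diamond n)) u v"
proof -
  interpret pair_graph "weighted_diamond n" by (rule pair_graph_weighted_diamond)
  have arc: "reachable (with_proj (weighted_diamond n)) x y"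
    if "(x, y) \<in> parcs (diamond i)" "i \<le> n" for x y i
    using that by (intro reachable_adjI) (auto simp: weighted_diamond_def)
  have "reachable (with_proj (weighted_diamond n)) Src x"
    if "x \<in> pverts (diamond i)" "i \<le> n" for x i
    using that
  proof (induction i arbitrary: x)
    case 0
    have "reachable (with_proj (weighted_diamond n)) Src Snk"
      by (rule arc[of _ _ 0]) (auto simp: diamond_def)
    with 0 show ?case
      using reachable_in_verts(1) reachable_refl by (auto simp: diamond_verts_0)
  next
    case (Suc i)
    show ?case
    proof (cases "x \<in> pverts (diamond i)")
      case False
      with Suc.prems obtain y z s where x: "x = New y z s" "(y, z) \<in> diamond_edges i"
        by (auto simp: diamond_verts_Suc)
      then have "y \<in> pverts (diamond i)" by (auto simp: diamond_def Field_def)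
      with Suc have "reachable (with_proj (weighted_diamond n)) Src y" by simp
      also have "(y, x) \<in> parcs (diamond (Suc i))"
        using x by (cases s) (force simp: diamond_def Let_def)+
      then have "reachable (with_proj (weighted_diamond n)) y x"
        using Suc.prems by (intro arc)
      finally (reachable_trans) show ?thesis .
    qed (use Suc in simp)
  qed
  with assms have "reachable (with_proj (weighted_diamond n)) Src u"
    "reachable (with_proj (weighted_diamond n)) Src v"
    by (auto simp: weighted_diamond_def)
  then show ?thesis by (meson symmetric_reachable' reachable_trans)
qed

lemma weighted_diamond_dist_finite:
  assumes "0 < \<epsilon>" "u \<in> pverts (weighted_diamond n)" "v \<in> pverts (weighted_diamond n)"
  shows "wf_digraph.\<mu> (with_proj (weighted_diamond n)) (diamond_weight \<epsilon>) u v =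
    ereal (weighted_diamond_dist \<epsilon> n u v)"
proof -
  interpret pair_graph "weighted_diamond n" by (rule pair_graph_weighted_diamond)
  have pos: "0 \<le> diamond_weight \<epsilon> e" for e
    using assms by (simp add: diamond_weight_def)
  have "0 \<le> \<mu> (diamond_weight \<epsilon>) u v"
    unfolding \<mu>_def by (rule INF_greatest) (auto intro: pos_cost_pos_awalk_cost pos)
  moreover obtain p where "awalk u p v"
    using weighted_diamond_connected[OF assms(2,3)] by (auto simp: reachable_awalk)
  then have "\<mu> (diamond_weight \<epsilon>) u v \<le> ereal (awalk_cost (diamond_weight \<epsilon>) p)"
    by (rule min_cost_le_walk_cost)
  ultimately show ?thesis
    unfolding weighted_diamond_dist_def by (cases "\<mu> (diamond_weight \<epsilon>) u v") auto
qed

section \<open>Low-distortion embeddings into Banach spaces\<close>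

definition distortion ::
  "'v set \<Rightarrow> ('v \<Rightarrow> 'v \<Rightarrow> real) \<Rightarrow> ('v \<Rightarrow> 'a::metric_space) \<Rightarrow> ennreal" where
  "distortion V d f =
    (SUP (x, y) \<in> {(x, y). x \<in> V \<and> y \<in> V \<and> x \<noteq> y}. ennreal (dist (f x) (f y) / d x y)) *
    (SUP (x, y) \<in> {(x, y). x \<in> V \<and> y \<in> V \<and> x \<noteq> y}. ennreal (d x y / dist (f x) (f y)))"

definition embeds_with_distortion ::
  "'v set \<Rightarrow> ('v \<Rightarrow> 'v \<Rightarrow> real) \<Rightarrow> 'a::metric_space set \<Rightarrow> real \<Rightarrow> bool" where
  "embeds_with_distortion V d X K \<longleftrightarrow>
    (\<exists>f. inj_on f V \<and> f ` V \<subseteq> X \<and> distortion V d f \<le> ennreal K)"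

text \<open>
  The Banach spaces whose norm and linear structure are inherited from the type \<^typ>\<open>'a\<close>. The
  whole type is one of them if \<^typ>\<open>'a\<close> is of class \<^class>\<open>banach\<close>.
\<close>

definition banach_subspaces :: "'a::real_normed_vector set set" where
  "banach_subspaces = {X. subspace X \<and> complete X}"

lemma UNIV_in_banach_subspaces: "(UNIV :: 'a::banach set) \<in> banach_subspaces"
  by (simp add: banach_subspaces_def complete_UNIV)

text \<open>
  \<open>dim X \<ge> r\<close>, where \<open>dim X\<close> may be infinite. The library constant \<^const>\<open>dim\<close> is 0 in that case
  and cannot be used.
\<close>

definition dim_at_least :: "'a::real_vector set \<Rightarrow> real \<Rightarrow> bool" where
  "dim_at_least X r \<longleftrightarrow>
    (\<exists>B \<subseteq> X. independent B \<and> X \<subseteq> span B \<and> (infinite B \<or> r \<le> real (card B)))"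

text \<open>
  The assertion about \<open>W\<^sub>n\<close> for given constants, for the Banach spaces in \<open>\<X>\<close>.
\<close>

definition diamonds_embed ::
  "real \<Rightarrow> real \<Rightarrow> real \<Rightarrow> real \<Rightarrow> 'a::real_normed_vector set set \<Rightarrow> bool" where
  "diamonds_embed \<epsilon> c C K \<X> \<longleftrightarrow>
    (\<forall>n. C \<le> real n \<longrightarrow>
      (\<forall>X \<in> \<X>.
        dim_at_least X (exp (c * (ln (ln (real (card (pverts (weighted_diamond n)))))) ^ 2)) \<longrightarrow>
        embeds_with_distortion
          (pverts (weighted_diamond n)) (weighted_diamond_dist \<epsilon> n) X K))"

text \<open>
  The constants \<open>c\<close>, \<open>C\<close>, \<open>K\<close> have to be the same for all Banach spaces, but a formula of HOL cannot
  quantify over types, and in \<open>\<exists>c C K. diamonds_embed \<epsilon> c C K (banach_subspaces :: 'a set set)\<close>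
  they could depend on \<^typ>\<open>'a\<close>. This is avoided by speaking of two types: constants exist for the
  Banach subspaces of \<open>\<ell>\<^sub>\<infinity>\<close>, a type without type variables (up to isometry these subspaces include all
  separable Banach spaces), and \<^emph>\<open>any\<close> constants that work there also work for the Banach spaces
  in an arbitrary type \<^typ>\<open>'a\<close>. The conjunction of the two, for all \<^typ>\<open>'a\<close>, says that one choice
  of constants, made without reference to \<^typ>\<open>'a\<close>, works for all Banach spaces.
\<close>

definition linf_subspaces :: "(nat \<Rightarrow>\<^sub>C real) set set" where
  "linf_subspaces = banach_subspaces"

end

theory Submission
  imports Defs
begin

text \<open>
  Why the theorem holds. Put \<open>w = 1/2 + \<epsilon>\<close>. Choose a vector \<open>X\<^sub>e\<close> of norm at most 1 for every edge \<open>e\<close>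
  of \<open>D\<^sub>0, \<dots>, D\<^bsub>n-1\<^esub>\<close>, and one more for the root index \<open>(Src, Src)\<close>. Define \<open>f\<close> by \<open>f Src = 0\<close>, by
  \<open>f Snk = \<epsilon> X\<^sub>r\<close> with \<open>r\<close> the root index, and by sending the two vertices that replace the edge \<open>e = uv\<close>
  of \<open>D\<^sub>i\<close> to \<open>(f u + f v) / 2 \<plusminus> \<epsilon> w\<^sup>i X\<^sub>e\<close>. Because \<open>w\<^sup>i / 2 + \<epsilon> w\<^sup>i\<close> is the weight of the next level,
  every edge is mapped to a vector not longer than its weight, whatever the \<open>X\<^sub>e\<close> are. So \<open>f\<close> is
  1-Lipschitz, and the task is a lower bound for the norm of \<open>f x - f y\<close>.

  The coefficient of \<open>\<epsilon> X\<^sub>e\<close> in \<open>f x\<close> is \<open>coef w e x\<close>, which depends on the graph and on \<open>w\<close> only. Two properties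
  of these coordinates are used. Up to a factor, \<open>d x y\<close> is bounded by the \<^emph>\<open>largest\<close> difference of a
  coordinate at \<open>x\<close> and at \<open>y\<close> (\<open>dist_le_coef_diff\<close>): the graph embeds into the space of families
  indexed by the edges, with the supremum norm. And up to a small multiple of \<open>d x y\<close>, the whole sum of
  the differences comes from a number \<open>m\<close> of coordinates that depends on \<open>\<epsilon>\<close> only
  (\<open>coef_diff_concentrated\<close>): on levels finer than the scale of \<open>d x y\<close> the coordinates themselves are
  small, and a coordinate of a coarser level varies slowly, because along an edge it is halved from
  level to level whereas the weights decrease by the larger factor \<open>w > 1/2\<close>.

  Hence it suffices that any \<open>m\<close> of the vectors \<open>X\<^sub>e\<close> satisfy \<open>norm (\<Sum>e. a\<^sub>e X\<^sub>e) \<ge> max \<bar>a\<^sub>e\<bar> / 4\<close>, with a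
  constant that does not deteriorate with \<open>m\<close>. In a space of dimension \<open>N\<close> a random choice does this
  (\<open>almost_independent_vectors\<close>). By volume considerations, here in the form of packing numbers, a
  random point of the unit ball has distance less than 1/2 from a given point with probability at most
  \<open>(3/4)\<^sup>N\<close>; apply this to \<open>X\<^sub>e\<close> and the combinations of the other vectors, for each \<open>e\<close> in turn. There are
  at most \<open>4\<^sup>n\<close> vectors, so a union bound works as soon as \<open>N \<ge> A n\<close> for a constant \<open>A\<close>. The dimension
  \<open>exp (2 (ln (ln \<bar>W\<^sub>n\<bar>))\<^sup>2)\<close> exceeds \<open>A n\<close> for large \<open>n\<close>, because \<open>ln \<bar>W\<^sub>n\<bar>\<close> grows at least linearly.

  Constants for the Banach subspaces of \<open>\<ell>\<^sub>\<infinity>\<close> work for all Banach spaces: a space of the given dimension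
  contains a finite-dimensional subspace of at least that dimension, which is separable and is mapped
  isometrically into \<open>\<ell>\<^sub>\<infinity>\<close> by countably many norming functionals.
\<close>

section \<open>Finite-dimensional subspaces of a normed space\<close>

lemma span_finite_coeffs:
  fixes B :: "'a::real_vector set"
  assumes "finite B" "x \<in> span B"
  obtains a where "x = (\<Sum>b\<in>B. a b *\<^sub>R b)"
  using assms by (auto simp: span_finite)

text \<open>
  If the coefficients are controlled by the norm, a Cauchy sequence has Cauchy coefficients.
\<close>

lemma coeffs_bound_imp_complete_span:
  fixes B :: "'a::real_normed_vector set"
  assumes B: "finite B" and c: "0 < c"
    and bound: "\<And>a b. b \<in> B \<Longrightarrow> c * \<bar>a b\<bar> \<le> norm (\<Sum>b\<in>B. a b *\<^sub>R b)"
  shows "complete (span B)"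
  unfolding complete_def
proof (intro allI impI, elim conjE)
  fix s :: "nat \<Rightarrow> 'a" assume s: "\<forall>n. s n \<in> span B" and Cauchy: "Cauchy s"
  have "\<forall>n. \<exists>a. s n = (\<Sum>b\<in>B. a b *\<^sub>R b)"
    using s B by (metis span_finite_coeffs)
  then obtain a where a: "\<And>n. s n = (\<Sum>b\<in>B. a n b *\<^sub>R b)" by metis
  have diff: "c * \<bar>a m b - a n b\<bar> \<le> norm (s m - s n)" if "b \<in> B" for b m n
    using bound[OF that, of "\<lambda>b. a m b - a n b"]
    by (simp add: a scaleR_left_diff_distrib sum_subtractf)
  have "\<exists>l. (\<lambda>n. a n b) \<longlonglongrightarrow> l" if "b \<in> B" for b
  proof -
    have "Cauchy (\<lambda>n. a n b)"
    proof (rule CauchyI)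
      fix e :: real assume "0 < e"
      with Cauchy c obtain M where M: "\<forall>m\<ge>M. \<forall>n\<ge>M. norm (s m - s n) < c * e"
        using CauchyD[of s "c * e"] by auto
      have "norm (a m b - a n b) < e" if "m \<ge> M" "n \<ge> M" for m n
      proof -
        have "c * \<bar>a m b - a n b\<bar> < c * e"
          using diff[OF \<open>b \<in> B\<close>, of m n] M that by force
        with c show ?thesis by simp
      qed
      then show "\<exists>M. \<forall>m\<ge>M. \<forall>n\<ge>M. norm (a m b - a n b) < e" by blast
    qed
    then show ?thesis using Cauchy_convergent convergent_def by blast
  qed
  then obtain l where l: "\<And>b. b \<in> B \<Longrightarrow> (\<lambda>n. a n b) \<longlonglongrightarrow> l b" by metis
  have "s \<longlonglongrightarrow> (\<Sum>b\<in>B. l b *\<^sub>R b)"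
    unfolding a[abs_def] by (intro tendsto_sum tendsto_scaleR l tendsto_const)
  moreover have "(\<Sum>b\<in>B. l b *\<^sub>R b) \<in> span B"
    by (intro span_sum span_scale span_base)
  ultimately show "\<exists>l\<in>span B. s \<longlonglongrightarrow> l" by blast
qed

text \<open>
  In finite dimension the coefficients with respect to a basis are bounded functionals. One vector
  is added at a time: it has positive distance from the span of the others, since that span is
  complete and hence closed.
\<close>

lemma independent_coeffs_bound:
  fixes B :: "'a::real_normed_vector set"
  assumes "finite B" "independent B"
  obtains c where "0 < c" "\<And>a b. b \<in> B \<Longrightarrow> c * \<bar>a b\<bar> \<le> norm (\<Sum>b\<in>B. a b *\<^sub>R b)"
proof -
  have "\<exists>c>0. \<forall>a. \<forall>b\<in>B. c * \<bar>a b\<bar> \<le> norm (\<Sum>b\<in>B. a b *\<^sub>R b)"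
    using assms
  proof (induction B rule: finite_induct)
    case empty
    show ?case by (auto intro: exI[of _ 1])
  next
    case (insert v B)
    then have indep: "independent B" and v: "v \<notin> span B"
      by (auto simp: independent_insert)
    from insert.IH[OF indep] obtain c where c: "0 < c"
      "\<And>a b. b \<in> B \<Longrightarrow> c * \<bar>a b\<bar> \<le> norm (\<Sum>b\<in>B. a b *\<^sub>R b)" by blast
    have "closed (span B)"
      by (rule complete_imp_closed, rule coeffs_bound_imp_complete_span[OF \<open>finite B\<close> c])
    moreover have "span B \<noteq> {}" using span_zero by blast
    ultimately have "0 < infdist v (span B)"
      using v by (intro infdist_pos_not_in_closed)
    then obtain \<delta> where \<delta>: "0 < \<delta>" "\<And>y. y \<in> span B \<Longrightarrow> \<delta> \<le> dist v y"
      using infdist_le by metis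
    \<comment> \<open>\<open>\<delta>\<close> bounds the coefficient of \<open>v\<close>; the remaining part of the vector then has norm at most
      \<open>1 + norm v / \<delta>\<close> times the norm of the whole.\<close>
    define c' where "c' = min \<delta> (c / (1 + norm v / \<delta>))"
    have "0 < c'"
      using c(1) \<delta>(1) by (auto simp: c'_def intro!: divide_pos_pos add_pos_nonneg)
    moreover have "c' * \<bar>a b\<bar> \<le> norm (\<Sum>b\<in>insert v B. a b *\<^sub>R b)" if b: "b \<in> insert v B" for a b
    proof -
      define y where "y = (\<Sum>b\<in>B. a b *\<^sub>R b)"
      define N where "N = norm (a v *\<^sub>R v + y)"
      have y: "y \<in> span B" unfolding y_def by (intro span_sum span_scale span_base)
      have av: "\<delta> * \<bar>a v\<bar> \<le> N"
      proof (cases "a v = 0")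
        case False
        have "\<delta> \<le> dist v (- (1 / a v) *\<^sub>R y)"
          by (rule \<delta>(2)) (intro span_scale y)
        also have "dist v (- (1 / a v) *\<^sub>R y) = norm ((1 / a v) *\<^sub>R (a v *\<^sub>R v + y))"
          using False by (simp add: dist_norm scaleR_add_right)
        also have "\<dots> = N / \<bar>a v\<bar>" by (simp add: N_def)
        finally show ?thesis using False by (simp add: field_simps)
      qed (simp add: N_def)
      have "norm y \<le> N + \<bar>a v\<bar> * norm v"
        using norm_triangle_ineq4[of "a v *\<^sub>R v + y" "a v *\<^sub>R v"] by (simp add: N_def)
      also have "\<dots> \<le> N + N / \<delta> * norm v"
        using av \<delta>(1) by (intro add_left_mono mult_right_mono) (simp_all add: field_simps)
      finally have ny: "norm y \<le> N * (1 + norm v / \<delta>)"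
        by (simp add: algebra_simps)
      have "c' * \<bar>a b\<bar> \<le> N"
      proof (cases "b = v")
        case True
        have "c' * \<bar>a v\<bar> \<le> \<delta> * \<bar>a v\<bar>" by (intro mult_right_mono) (auto simp: c'_def)
        with av True show ?thesis by simp
      next
        case False
        with b have "b \<in> B" by simp
        have pos: "0 < 1 + norm v / \<delta>" using \<delta>(1) by (intro add_pos_nonneg) auto
        have "c' * \<bar>a b\<bar> \<le> c / (1 + norm v / \<delta>) * \<bar>a b\<bar>"
          by (intro mult_right_mono) (auto simp: c'_def)
        also have "\<dots> = c * \<bar>a b\<bar> / (1 + norm v / \<delta>)" by simp
        also have "\<dots> \<le> N"
          using c(2)[OF \<open>b \<in> B\<close>, of a] ny pos by (simp add: pos_divide_le_eq y_def)
        finally show ?thesis .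
      qed
      moreover have "(\<Sum>b\<in>insert v B. a b *\<^sub>R b) = a v *\<^sub>R v + y"
        using insert.hyps by (simp add: y_def)
      ultimately show ?thesis by (simp add: N_def)
    qed
    ultimately show ?case by blast
  qed
  then show thesis using that by blast
qed

lemma complete_span_finite:
  fixes B :: "'a::real_normed_vector set"
  assumes "finite B"
  shows "complete (span B)"
proof -
  obtain B' where B': "B' \<subseteq> B" "independent B'" "span B' = span B"
    by (metis maximal_independent_subset span_mono span_span subset_antisym)
  then have "finite B'" using assms finite_subset by blast
  then obtain c where "0 < c" "\<And>a b. b \<in> B' \<Longrightarrow> c * \<bar>a b\<bar> \<le> norm (\<Sum>b\<in>B'. a b *\<^sub>R b)"
    using independent_coeffs_bound[OF _ B'(2)] by metis
  then have "complete (span B')"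
    by (rule coeffs_bound_imp_complete_span[OF \<open>finite B'\<close>])
  with B'(3) show ?thesis by simp
qed

section \<open>Vectors of which any few are uniformly independent\<close>

abbreviation separated :: "real \<Rightarrow> 'a::metric_space set \<Rightarrow> bool" where
  "separated t \<equiv> pairwise (\<lambda>x y. t \<le> dist x y)"

text \<open>
  Points with the same rounded coefficients are closer than \<open>t\<close>, and there are finitely many
  rounded coefficient families in the unit ball.
\<close>

lemma card_separated_le:
  fixes B :: "'a::real_normed_vector set"
  assumes B: "finite B" "independent B" and t: "0 < t"
  obtains M where "\<And>P. P \<subseteq> span B \<inter> cball 0 1 \<Longrightarrow> separated t P \<Longrightarrow> finite P \<and> card P \<le> M"
proof -
  obtain c where c: "0 < c" "\<And>a b. b \<in> B \<Longrightarrow> c * \<bar>a b\<bar> \<le> norm (\<Sum>b\<in>B. a b *\<^sub>R b)"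
    using independent_coeffs_bound[OF B] by metis
  define S where "S = 1 + (\<Sum>b\<in>B. norm b)"
  have S: "0 < S" "(\<Sum>b\<in>B. norm b) < S" unfolding S_def by (auto intro!: add_pos_nonneg sum_nonneg)
  define L where "L = S / t"
  have L: "0 < L" using S t by (simp add: L_def)
  obtain a where a: "\<And>x. x \<in> span B \<Longrightarrow> (\<Sum>b\<in>B. a x b *\<^sub>R b) = x"
  proof -
    have "\<forall>x\<in>span B. \<exists>a. (\<Sum>b\<in>B. a b *\<^sub>R b) = x"
      using span_finite_coeffs[OF B(1)] by blast
    from bchoice[OF this] show ?thesis using that by blast
  qed
  define grid where "grid = B \<rightarrow>\<^sub>E {\<lfloor>- L / c\<rfloor>..\<lfloor>L / c\<rfloor>}"
  define q where "q x = (\<lambda>b\<in>B. \<lfloor>L * a x b\<rfloor>)" for x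
  have fin: "finite grid" using B by (simp add: grid_def finite_PiE)
  show thesis
  proof (rule that[of "card grid"])
    fix P assume P: "P \<subseteq> span B \<inter> cball 0 1" "separated t P"
    have "q x \<in> grid" if "x \<in> P" for x
      unfolding q_def grid_def
    proof (rule restrict_PiE_iff[THEN iffD2], rule ballI)
      fix b assume b: "b \<in> B"
      have x: "x \<in> span B" "norm x \<le> 1" using P that by auto
      have "c * \<bar>a x b\<bar> \<le> 1" using c(2)[OF b, of "a x"] a[OF x(1)] x(2) by simp
      then have "\<bar>a x b\<bar> \<le> 1 / c" using c(1) by (simp add: field_simps)
      then have "- 1 / c \<le> a x b" "a x b \<le> 1 / c" by auto
      then have "L * (- 1 / c) \<le> L * a x b" "L * a x b \<le> L * (1 / c)"
        using L by (intro mult_left_mono; simp)+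
      then show "\<lfloor>L * a x b\<rfloor> \<in> {\<lfloor>- L / c\<rfloor>..\<lfloor>L / c\<rfloor>}"
        unfolding atLeastAtMost_iff by (intro conjI floor_mono) simp_all
    qed
    then have sub: "q ` P \<subseteq> grid" by blast
    have inj: "inj_on q P"
    proof (rule inj_onI, rule ccontr)
      fix x y assume xy: "x \<in> P" "y \<in> P" "q x = q y" "x \<noteq> y"
      then have span: "x \<in> span B" "y \<in> span B" using P by auto
      have "norm ((a x b - a y b) *\<^sub>R b) \<le> (1 / L) * norm b" if "b \<in> B" for b
      proof -
        have "\<lfloor>L * a x b\<rfloor> = \<lfloor>L * a y b\<rfloor>" using fun_cong[OF xy(3), of b] that by (simp add: q_def)
        then have "\<bar>L * a x b - L * a y b\<bar> \<le> 1" by linarith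
        then have "L * \<bar>a x b - a y b\<bar> \<le> 1" using L by (simp add: abs_mult right_diff_distrib[symmetric])
        then have "\<bar>a x b - a y b\<bar> \<le> 1 / L" using L by (simp add: field_simps)
        then show ?thesis unfolding norm_scaleR by (intro mult_right_mono) auto
      qed
      then have "norm (\<Sum>b\<in>B. (a x b - a y b) *\<^sub>R b) \<le> (\<Sum>b\<in>B. (1 / L) * norm b)"
        by (intro sum_norm_le) auto
      also have "(\<Sum>b\<in>B. (a x b - a y b) *\<^sub>R b) = x - y"
        using a[OF span(1)] a[OF span(2)] by (simp add: scaleR_left_diff_distrib sum_subtractf)
      also have "(\<Sum>b\<in>B. (1 / L) * norm b) = t * (\<Sum>b\<in>B. norm b) / S"
        by (simp add: L_def sum_divide_distrib sum_distrib_left)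
      also have "\<dots> < t" using S t by (simp add: field_simps)
      finally show False using pairwiseD[OF P(2) xy(1,2,4)] by (simp add: dist_norm)
    qed
    show "finite P \<and> card P \<le> card grid"
      using inj_on_finite[OF inj sub fin] card_inj_on_le[OF inj sub fin] by blast
  qed
qed

text \<open>
  A grid in the unit ball shows that packing numbers grow at least like the power of the inverse
  scale that is given by the dimension.
\<close>

lemma separated_set_exists:
  fixes B :: "'a::real_normed_vector set"
  assumes B: "finite B" "independent B"
  obtains s where "0 < s"
    "\<And>k. \<exists>P. P \<subseteq> span B \<inter> cball 0 1 \<and> separated (s / 2 ^ k) P \<and> card P = (2 ^ k) ^ card B"
proof -
  obtain c where c: "0 < c" "\<And>a b. b \<in> B \<Longrightarrow> c * \<bar>a b\<bar> \<le> norm (\<Sum>b\<in>B. a b *\<^sub>R b)"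
    using independent_coeffs_bound[OF B] by metis
  define S where "S = 1 + (\<Sum>b\<in>B. norm b)"
  have S: "0 < S" "(\<Sum>b\<in>B. norm b) \<le> S" unfolding S_def by (auto intro!: add_pos_nonneg sum_nonneg)
  have "\<exists>P. P \<subseteq> span B \<inter> cball 0 1 \<and> separated (c / S / 2 ^ k) P \<and> card P = (2 ^ k) ^ card B" for k
  proof -
    define grid :: "('a \<Rightarrow> nat) set" where "grid = B \<rightarrow>\<^sub>E {..<2 ^ k}"
    define v where "v g = (\<Sum>b\<in>B. (real (g b) / (2 ^ k * S)) *\<^sub>R b)" for g
    have sep: "c / S / 2 ^ k \<le> dist (v g) (v h)" if gh: "g \<in> grid" "h \<in> grid" "g \<noteq> h" for g h
    proof -
      obtain b where b: "b \<in> B" "g b \<noteq> h b"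
        using PiE_ext[OF gh(1,2)[unfolded grid_def]] gh(3) by blast
      have "c * (1 / (2 ^ k * S)) \<le> c * (\<bar>real (g b) - real (h b)\<bar> / (2 ^ k * S))"
        using b c S by (intro mult_left_mono divide_right_mono) auto
      also have "\<bar>real (g b) - real (h b)\<bar> / (2 ^ k * S) = \<bar>real (g b) / (2 ^ k * S) - real (h b) / (2 ^ k * S)\<bar>"
        using S by (simp add: abs_divide flip: diff_divide_distrib)
      also have "c * \<dots> \<le> norm (\<Sum>b\<in>B. (real (g b) / (2 ^ k * S) - real (h b) / (2 ^ k * S)) *\<^sub>R b)"
        by (rule c(2)[OF b(1)])
      also have "\<dots> = dist (v g) (v h)"
        by (simp add: v_def dist_norm scaleR_left_diff_distrib sum_subtractf)
      finally show ?thesis by (simp add: mult.commute)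
    qed
    have inj: "inj_on v grid"
    proof (rule inj_onI, rule ccontr)
      fix g h assume "g \<in> grid" "h \<in> grid" "v g = v h" "g \<noteq> h"
      with sep[of g h] c S show False by (simp add: field_simps)
    qed
    have "v ` grid \<subseteq> span B \<inter> cball 0 1"
    proof (intro image_subsetI IntI)
      fix g assume g: "g \<in> grid"
      show "v g \<in> span B" unfolding v_def by (intro span_sum span_scale span_base)
      have "norm (v g) \<le> (\<Sum>b\<in>B. (1 / S) * norm b)"
        unfolding v_def
      proof (rule sum_norm_le)
        fix b assume "b \<in> B"
        then have "g b < 2 ^ k" using g by (auto simp: grid_def)
        then have "real (g b) \<le> real (2 ^ k)" by (simp only: of_nat_le_iff less_imp_le)
        then have "real (g b) \<le> 2 ^ k" by simp
        then have "real (g b) / (2 ^ k * S) \<le> 1 / S" using S by (simp add: field_simps)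
        then show "norm ((real (g b) / (2 ^ k * S)) *\<^sub>R b) \<le> (1 / S) * norm b"
          using S unfolding norm_scaleR by (intro mult_right_mono) auto
      qed
      also have "\<dots> = (\<Sum>b\<in>B. norm b) / S" by (simp add: sum_divide_distrib)
      also have "\<dots> \<le> 1" using S by simp
      finally show "v g \<in> cball 0 1" by simp
    qed
    moreover have "separated (c / S / 2 ^ k) (v ` grid)"
      using sep unfolding pairwise_def by blast
    moreover have "card (v ` grid) = (2 ^ k) ^ card B"
      using card_image[OF inj] B by (simp add: grid_def card_PiE)
    ultimately show ?thesis by blast
  qed
  then show thesis using that[of "c / S"] c S by simp
qed

text \<open>
  A finite substitute for the uniform distribution on the unit ball: every ball of radius 1/2
  contains only an exponentially small proportion of \<open>P\<close>. Let \<open>g t\<close> be the largest size of a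
  \<open>t\<close>-separated set in the unit ball. Scaling by 2 shows that a ball of radius 1/2 contains at most
  \<open>g (2 t)\<close> points of a \<open>t\<close>-separated set. If \<open>g (2 t) > (3/4)\<^sup>N g t\<close> held for all \<open>t = s / 2\<^sup>k\<close>, then
  \<open>g (s / 2\<^sup>k)\<close> would grow at most like \<open>(4/3)\<^bsup>N k\<^esup>\<close>, although it is at least \<open>2\<^bsup>N k\<^esup>\<close>. So a largest
  \<open>t\<close>-separated set does it for some such \<open>t\<close>.
\<close>

lemma spread_set_exists:
  fixes B :: "'a::real_normed_vector set"
  assumes B: "finite B" "independent B"
  obtains P where "finite P" "P \<noteq> {}" "P \<subseteq> span B \<inter> cball 0 1"
    "\<And>y. y \<in> span B \<Longrightarrow> real (card {p \<in> P. dist p y < 1 / 2}) \<le> (3 / 4) ^ card B * card P"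
proof -
  let ?U = "span B \<inter> cball 0 1" and ?N = "card B"
  have "\<exists>P. P \<subseteq> ?U \<and> separated t P \<and> finite P \<and>
      (\<forall>Q. Q \<subseteq> ?U \<and> separated t Q \<longrightarrow> card Q \<le> card P)" if t: "0 < t" for t
  proof -
    obtain M where M: "\<And>P. P \<subseteq> ?U \<Longrightarrow> separated t P \<Longrightarrow> finite P \<and> card P \<le> M"
      using card_separated_le[OF B t] by blast
    then have "\<exists>P. (P \<subseteq> ?U \<and> separated t P) \<and> (\<forall>Q. Q \<subseteq> ?U \<and> separated t Q \<longrightarrow> card Q \<le> card P)"
      by (intro ex_has_greatest_nat[of _ "{}" card "Suc M"]) (auto simp: less_Suc_eq_le pairwise_empty)
    then show ?thesis using M by blast
  qed
  then obtain P where P: "\<And>t. 0 < t \<Longrightarrow> P t \<subseteq> ?U" "\<And>t. 0 < t \<Longrightarrow> separated t (P t)"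
      "\<And>t. 0 < t \<Longrightarrow> finite (P t)"
      and max: "\<And>t Q. 0 < t \<Longrightarrow> Q \<subseteq> ?U \<Longrightarrow> separated t Q \<Longrightarrow> card Q \<le> card (P t)"
    by metis
  have half_ball: "card {p \<in> P t. dist p y < 1 / 2} \<le> card (P (2 * t))" if t: "0 < t" and y: "y \<in> span B" for t y
  proof -
    define Q where "Q = {p \<in> P t. dist p y < 1 / 2}"
    define h where "h p = 2 *\<^sub>R (p - y)" for p
    have h: "dist (h p) (h q) = 2 * dist p q" for p q
      by (simp add: h_def dist_norm flip: scaleR_right_diff_distrib)
    have inj: "inj_on h Q" by (rule inj_onI) (simp add: h_def)
    have "h ` Q \<subseteq> ?U"
      using P(1)[OF t] y by (auto simp: h_def Q_def dist_norm intro!: span_scale span_diff)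
    moreover have "separated (2 * t) (h ` Q)"
      using P(2)[OF t] by (auto simp: pairwise_image pairwise_def Q_def h)
    ultimately have "card (h ` Q) \<le> card (P (2 * t))" using t by (intro max) auto
    then show ?thesis using card_image[OF inj] by (simp add: Q_def)
  qed
  obtain s where s: "0 < s"
    "\<And>k. \<exists>Q. Q \<subseteq> ?U \<and> separated (s / 2 ^ k) Q \<and> card Q = (2 ^ k) ^ ?N"
    using separated_set_exists[OF B] by metis
  have lower: "(2 ^ k) ^ ?N \<le> card (P (s / 2 ^ k))" for k
    using s(2)[of k] max[of "s / 2 ^ k"] s(1) by (metis divide_pos_pos zero_less_numeral zero_less_power)
  have "\<exists>k. \<forall>y\<in>span B. card {p \<in> P (s / 2 ^ k). dist p y < 1 / 2} \<le> (3 / 4) ^ ?N * card (P (s / 2 ^ k))"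
  proof (rule ccontr)
    assume contr: "\<not> ?thesis"
    then have ex: "\<exists>y\<in>span B. (3 / 4) ^ ?N * card (P (s / 2 ^ k)) < card {p \<in> P (s / 2 ^ k). dist p y < 1 / 2}"
      for k by (auto simp: not_le)
    have step: "(3 / 4) ^ ?N * card (P (s / 2 ^ k)) < card (P (2 * (s / 2 ^ k)))" for k
    proof -
      obtain y where y: "y \<in> span B"
        "(3 / 4) ^ ?N * card (P (s / 2 ^ k)) < card {p \<in> P (s / 2 ^ k). dist p y < 1 / 2}"
        using ex[of k] by blast
      moreover have "card {p \<in> P (s / 2 ^ k). dist p y < 1 / 2} \<le> card (P (2 * (s / 2 ^ k)))"
        using half_ball[OF _ y(1), of "s / 2 ^ k"] s(1) by simp
      ultimately show ?thesis by linarith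
    qed
    have N: "?N \<noteq> 0"
    proof
      assume N0: "?N = 0"
      obtain y where "(3 / 4) ^ ?N * card (P (s / 2 ^ 0)) < card {p \<in> P (s / 2 ^ 0). dist p y < 1 / 2}"
        using ex[of 0] by blast
      moreover have "card {p \<in> P (s / 2 ^ 0). dist p y < 1 / 2} \<le> card (P (s / 2 ^ 0))"
        using P(3)[of s] s(1) by (intro card_mono) auto
      ultimately show False using N0 by simp
    qed
    have decay: "((3 / 4) ^ ?N) ^ k * card (P (s / 2 ^ k)) \<le> card (P s)" for k
    proof (induction k)
      case (Suc k)
      have "((3 / 4) ^ ?N) ^ Suc k * card (P (s / 2 ^ Suc k)) =
          ((3 / 4) ^ ?N) ^ k * ((3 / 4) ^ ?N * card (P (s / 2 ^ Suc k)))" by simp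
      also have "\<dots> \<le> ((3 / 4) ^ ?N) ^ k * card (P (2 * (s / 2 ^ Suc k)))"
        by (intro mult_left_mono less_imp_le[OF step]) simp
      also have "2 * (s / 2 ^ Suc k) = s / 2 ^ k" by simp
      finally show ?case using Suc.IH by linarith
    qed simp
    have "((3 / 2) ^ ?N) ^ k \<le> real (card (P s))" for k
    proof -
      have "((3 / 2) ^ ?N) ^ k = ((3 / 4 :: real) ^ ?N) ^ k * (2 ^ k) ^ ?N"
      proof -
        have "(3 / 2 :: real) ^ ?N = (3 / 4) ^ ?N * 2 ^ ?N" by (simp flip: power_mult_distrib)
        moreover have "((2 :: real) ^ ?N) ^ k = (2 ^ k) ^ ?N"
          unfolding power_mult[symmetric] by (simp only: mult.commute)
        ultimately show ?thesis by (simp only: power_mult_distrib)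
      qed
      also have "\<dots> \<le> ((3 / 4) ^ ?N) ^ k * real (card (P (s / 2 ^ k)))"
      proof (rule mult_left_mono)
        have "real ((2 ^ k) ^ ?N) \<le> real (card (P (s / 2 ^ k)))"
          using lower[of k] by (simp only: of_nat_le_iff)
        then show "(2 ^ k) ^ ?N \<le> real (card (P (s / 2 ^ k)))" by simp
      qed simp
      finally show ?thesis using decay[of k] by linarith
    qed
    moreover have "1 < (3 / 2 :: real) ^ ?N" using N by (intro one_less_power) auto
    then obtain k where "real (card (P s)) < ((3 / 2) ^ ?N) ^ k" using real_arch_pow by blast
    ultimately show False by (meson not_le)
  qed
  then obtain k where k: "\<And>y. y \<in> span B \<Longrightarrow>
      card {p \<in> P (s / 2 ^ k). dist p y < 1 / 2} \<le> (3 / 4) ^ ?N * card (P (s / 2 ^ k))" by blast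
  have "0 < s / 2 ^ k" using s(1) by simp
  moreover have "P (s / 2 ^ k) \<noteq> {}"
    using lower[of k] by auto
  ultimately show thesis using that[of "P (s / 2 ^ k)"] P k by blast
qed

text \<open>
  In probabilistic terms: if \<open>\<phi>\<close> is a random family of points of \<open>P\<close>, then \<open>\<phi> e\<close> is independent of
  the other members, so it is close to a point determined by them with probability at most \<open>q\<close>.
\<close>

lemma card_PiE_close_le:
  fixes P :: "'a::metric_space set" and q :: real
  assumes "finite I" "e \<in> I" "finite P"
    and close: "\<And>\<phi>. \<phi> \<in> (I - {e}) \<rightarrow>\<^sub>E P \<Longrightarrow> real (card {p \<in> P. dist p (y \<phi>) < r}) \<le> q * card P"
  shows "real (card {\<phi> \<in> I \<rightarrow>\<^sub>E P. dist (\<phi> e) (y (restrict \<phi> (I - {e}))) < r}) \<le> q * card (I \<rightarrow>\<^sub>E P)"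
proof -
  let ?I = "I - {e}"
  have fin: "finite (?I \<rightarrow>\<^sub>E P)" using assms by (simp add: finite_PiE)
  have "{\<phi> \<in> I \<rightarrow>\<^sub>E P. dist (\<phi> e) (y (restrict \<phi> ?I)) < r} \<subseteq>
      (\<Union>\<psi>\<in>?I \<rightarrow>\<^sub>E P. (\<lambda>p. \<psi>(e := p)) ` {p \<in> P. dist p (y \<psi>) < r})"
  proof
    fix \<phi> assume "\<phi> \<in> {\<phi> \<in> I \<rightarrow>\<^sub>E P. dist (\<phi> e) (y (restrict \<phi> ?I)) < r}"
    then have \<phi>: "\<phi> \<in> I \<rightarrow>\<^sub>E P" "dist (\<phi> e) (y (restrict \<phi> ?I)) < r" by auto
    have "restrict \<phi> ?I \<in> ?I \<rightarrow>\<^sub>E P" using \<phi>(1) by auto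
    moreover have "\<phi> e \<in> {p \<in> P. dist p (y (restrict \<phi> ?I)) < r}" using \<phi> assms(2) by auto
    moreover have "\<phi> = (restrict \<phi> ?I)(e := \<phi> e)"
    proof
      fix i show "\<phi> i = ((restrict \<phi> ?I)(e := \<phi> e)) i"
        using PiE_arb[OF \<phi>(1), of i] by simp
    qed
    ultimately show "\<phi> \<in> (\<Union>\<psi>\<in>?I \<rightarrow>\<^sub>E P. (\<lambda>p. \<psi>(e := p)) ` {p \<in> P. dist p (y \<psi>) < r})" by blast
  qed
  then have "card {\<phi> \<in> I \<rightarrow>\<^sub>E P. dist (\<phi> e) (y (restrict \<phi> ?I)) < r} \<le>
      card (\<Union>\<psi>\<in>?I \<rightarrow>\<^sub>E P. (\<lambda>p. \<psi>(e := p)) ` {p \<in> P. dist p (y \<psi>) < r})"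
    using fin assms(3) by (intro card_mono) auto
  also have "\<dots> \<le> (\<Sum>\<psi>\<in>?I \<rightarrow>\<^sub>E P. card ((\<lambda>p. \<psi>(e := p)) ` {p \<in> P. dist p (y \<psi>) < r}))"
    by (rule card_UN_le[OF fin])
  also have "\<dots> \<le> (\<Sum>\<psi>\<in>?I \<rightarrow>\<^sub>E P. card {p \<in> P. dist p (y \<psi>) < r})"
    using assms(3) by (intro sum_mono card_image_le) auto
  finally have "real (card {\<phi> \<in> I \<rightarrow>\<^sub>E P. dist (\<phi> e) (y (restrict \<phi> ?I)) < r}) \<le>
      (\<Sum>\<psi>\<in>?I \<rightarrow>\<^sub>E P. real (card {p \<in> P. dist p (y \<psi>) < r}))"
    by (simp flip: of_nat_sum)
  also have "\<dots> \<le> (\<Sum>\<psi>\<in>?I \<rightarrow>\<^sub>E P. q * card P)" by (intro sum_mono close)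
  also have "\<dots> = q * (card P ^ card ?I * card P)"
    using assms(1) by (simp add: card_PiE)
  also have "card P ^ card ?I * card P = card (I \<rightarrow>\<^sub>E P)"
  proof -
    have "card I = Suc (card ?I)" using card_Suc_Diff1[OF assms(1,2)] by simp
    then show ?thesis using assms(1) by (simp add: card_PiE)
  qed
  finally show ?thesis .
qed

text \<open>
  A union bound over all \<open>e\<close> and all combinations \<open>as\<close> of \<open>m\<close> terms with coefficients in \<open>G\<close>. Every
  index takes the role of \<open>e\<close>, which makes the constant 1/2 independent of \<open>m\<close>. Terms of \<open>as\<close> with index \<open>e\<close> count as 0, so
  that \<open>(e, 0)\<close> can be used to pad shorter combinations.
\<close>

lemma independent_choice_exists:
  fixes B :: "'a::real_normed_vector set" and I :: "'i set" and G :: "real set"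
  assumes B: "finite B" "independent B" and I: "finite I" and G: "finite G"
    and small: "card I * (card I * card G) ^ m * (3 / 4) ^ card B < (1 :: real)"
  obtains x where "\<And>i. i \<in> I \<Longrightarrow> x i \<in> span B \<and> norm (x i) \<le> 1"
    "\<And>e as. e \<in> I \<Longrightarrow> set as \<subseteq> I \<times> G \<Longrightarrow> length as = m \<Longrightarrow>
      1 / 2 \<le> norm (x e + (\<Sum>(i, \<gamma>)\<leftarrow>as. if i = e then 0 else \<gamma> *\<^sub>R x i))"
proof -
  obtain P where P: "finite P" "P \<noteq> {}" "P \<subseteq> span B \<inter> cball 0 1"
    "\<And>y. y \<in> span B \<Longrightarrow> real (card {p \<in> P. dist p y < 1 / 2}) \<le> (3 / 4) ^ card B * card P"
    using spread_set_exists[OF B] by blast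
  define comb where "comb \<phi> e as = - (\<Sum>(i, \<gamma>)\<leftarrow>as. if i = e then 0 else \<gamma> *\<^sub>R \<phi> i)"
    for \<phi> :: "'i \<Rightarrow> 'a" and e as
  define T where "T = I \<times> {as. set as \<subseteq> I \<times> G \<and> length as = m}"
  define bad where "bad = (\<lambda>(e, as). {\<phi> \<in> I \<rightarrow>\<^sub>E P. dist (\<phi> e) (comb (restrict \<phi> (I - {e})) e as) < 1 / 2})"
  have comb_in: "comb \<phi> e as \<in> span B" if "\<phi> \<in> (I - {e}) \<rightarrow>\<^sub>E P" "set as \<subseteq> I \<times> G" for \<phi> e as
  proof -
    have "(\<Sum>(i, \<gamma>)\<leftarrow>as. if i = e then 0 else \<gamma> *\<^sub>R \<phi> i) \<in> span B"
      using that(2)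
    proof (induction as)
      case (Cons a as)
      obtain i \<gamma> where a: "a = (i, \<gamma>)" by (cases a)
      have "(if i = e then 0 else \<gamma> *\<^sub>R \<phi> i) \<in> span B"
      proof (cases "i = e")
        case False
        then have "\<phi> i \<in> P" using Cons.prems that(1) a by auto
        then have "\<phi> i \<in> span B" using P(3) by blast
        then show ?thesis using False by (simp add: span_scale)
      qed (simp add: span_zero)
      then show ?case using Cons by (simp add: a span_add)
    qed (simp add: span_zero)
    then show ?thesis by (simp add: comb_def span_neg)
  qed
  have fin: "finite (I \<rightarrow>\<^sub>E P)" using I P(1) by (simp add: finite_PiE)
  have finT: "finite T" using I G by (simp add: T_def finite_lists_length_eq)
  have finbad: "finite (bad t)" for t
    using fin by (simp add: bad_def case_prod_unfold)
  have bad_le: "real (card (bad t)) \<le> (3 / 4) ^ card B * card (I \<rightarrow>\<^sub>E P)" if t_in: "t \<in> T" for t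
  proof -
    obtain e as where t: "t = (e, as)" "e \<in> I" "set as \<subseteq> I \<times> G"
      using t_in by (cases t) (auto simp: T_def)
    show ?thesis unfolding bad_def t(1) prod.case
      by (rule card_PiE_close_le[OF I t(2) P(1)]) (intro P(4) comb_in t(3))
  qed
  have "real (card (\<Union>t\<in>T. bad t)) \<le> (\<Sum>t\<in>T. real (card (bad t)))"
    using card_UN_le[OF finT, of bad] by (simp flip: of_nat_sum)
  also have "\<dots> \<le> (\<Sum>t\<in>T. (3 / 4) ^ card B * card (I \<rightarrow>\<^sub>E P))"
    by (intro sum_mono bad_le)
  also have "\<dots> = (card I * (card I * card G) ^ m * (3 / 4) ^ card B) * card (I \<rightarrow>\<^sub>E P)"
    using I G by (simp add: T_def card_cartesian_product card_lists_length_eq)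
  also have "\<dots> < (1::real) * card (I \<rightarrow>\<^sub>E P)"
    using small P(1,2) I by (intro mult_strict_right_mono) (simp_all add: card_PiE card_gt_0_iff)
  finally have "card (\<Union>t\<in>T. bad t) < card (I \<rightarrow>\<^sub>E P)" by simp
  then have "\<not> (I \<rightarrow>\<^sub>E P) \<subseteq> (\<Union>t\<in>T. bad t)"
    using card_mono[of "\<Union>t\<in>T. bad t" "I \<rightarrow>\<^sub>E P"] finT finbad by auto
  then obtain \<phi> where \<phi>: "\<phi> \<in> I \<rightarrow>\<^sub>E P" "\<And>t. t \<in> T \<Longrightarrow> \<phi> \<notin> bad t" by blast
  show thesis
  proof (rule that[of \<phi>])
    fix i assume "i \<in> I"
    then have "\<phi> i \<in> P" using \<phi>(1) by auto
    then show "\<phi> i \<in> span B \<and> norm (\<phi> i) \<le> 1" using P(3) by auto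
  next
    fix e as assume e: "e \<in> I" "set as \<subseteq> I \<times> G" "length as = m"
    then have "\<phi> \<notin> bad (e, as)" by (intro \<phi>(2)) (simp add: T_def)
    then have "1 / 2 \<le> dist (\<phi> e) (comb (restrict \<phi> (I - {e})) e as)"
      using \<phi>(1) by (auto simp: bad_def)
    also have "comb (restrict \<phi> (I - {e})) e as = comb \<phi> e as"
      unfolding comb_def using e(2) by (intro arg_cong[of _ _ uminus] arg_cong[of _ _ sum_list] map_cong) auto
    finally show "1 / 2 \<le> norm (\<phi> e + (\<Sum>(i, \<gamma>)\<leftarrow>as. if i = e then 0 else \<gamma> *\<^sub>R \<phi> i))"
      by (simp add: comb_def dist_norm)
  qed
qed

text \<open>
  Normalise the largest coefficient to 1. The others are then in the unit interval around 0, and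
  rounding them to multiples of \<open>1 / (4 m)\<close> changes the sum by at most 1/4. There are at most
  \<open>8 m + 1 \<le> 9 m\<close> such multiples.
\<close>

lemma almost_independent_vectors:
  fixes B :: "'a::real_normed_vector set" and I :: "'i set"
  assumes B: "finite B" "independent B" and I: "finite I" and m: "0 < m"
    and small: "card I * (card I * (9 * m)) ^ m * (3 / 4) ^ card B < (1 :: real)"
  obtains x where "\<And>i. i \<in> I \<Longrightarrow> x i \<in> span B \<and> norm (x i) \<le> 1"
    "\<And>S a e R. S \<subseteq> I \<Longrightarrow> card S \<le> m \<Longrightarrow> e \<in> S \<Longrightarrow> \<bar>a e\<bar> = R \<Longrightarrow> (\<And>i. i \<in> S \<Longrightarrow> \<bar>a i\<bar> \<le> R) \<Longrightarrow>
      R / 4 \<le> norm (\<Sum>i\<in>S. a i *\<^sub>R x i)"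
proof -
  define G :: "real set" where "G = (\<lambda>j. real_of_int j / (4 * m)) ` {- 4 * int m..4 * int m}"
  have G: "finite G" "0 \<in> G" by (auto simp: G_def image_iff intro!: bexI[of _ 0])
  have "card G \<le> card {- 4 * int m..4 * int m}" unfolding G_def by (rule card_image_le) simp
  also have "\<dots> \<le> 9 * m" using m by simp
  finally have "(card I * card G) ^ m \<le> (card I * (9 * m)) ^ m" by (intro power_mono mult_left_mono) auto
  then have "real (card I * (card I * card G) ^ m) * (3 / 4) ^ card B \<le> real (card I * (card I * (9 * m)) ^ m) * (3 / 4) ^ card B"
    by (intro mult_right_mono of_nat_mono mult_left_mono) simp_all
  with small have "card I * (card I * card G) ^ m * (3 / 4) ^ card B < (1 :: real)" by linarith
  then obtain x where x: "\<And>i. i \<in> I \<Longrightarrow> x i \<in> span B \<and> norm (x i) \<le> 1"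
    and sep: "\<And>e as. e \<in> I \<Longrightarrow> set as \<subseteq> I \<times> G \<Longrightarrow> length as = m \<Longrightarrow>
      1 / 2 \<le> norm (x e + (\<Sum>(i, \<gamma>)\<leftarrow>as. if i = e then 0 else \<gamma> *\<^sub>R x i))"
    using independent_choice_exists[OF B I G(1)] by blast
  have unit: "1 / 4 \<le> norm (x e + (\<Sum>i\<in>S - {e}. b i *\<^sub>R x i))"
    if S: "S \<subseteq> I" "card S \<le> m" "e \<in> S" and b: "\<And>i. i \<in> S \<Longrightarrow> \<bar>b i\<bar> \<le> 1" for S b e
  proof -
    have finS: "finite S" using S(1) I finite_subset by blast
    define \<gamma> where "\<gamma> i = real_of_int \<lfloor>4 * m * b i\<rfloor> / (4 * m)" for i
    have \<gamma>G: "\<gamma> i \<in> G" if "i \<in> S" for i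
    proof -
      have "- (4 * real m) \<le> 4 * m * b i" "4 * m * b i \<le> 4 * real m"
        using mult_left_mono[of "- 1" "b i" "4 * real m"] mult_left_mono[of "b i" 1 "4 * real m"]
          b[OF that] by auto
      then have "\<lfloor>4 * m * b i\<rfloor> \<in> {- 4 * int m..4 * int m}"
        by (auto simp: le_floor_iff floor_le_iff)
      then show ?thesis unfolding G_def \<gamma>_def by blast
    qed
    have \<gamma>b: "\<bar>\<gamma> i - b i\<bar> \<le> 1 / (4 * m)" for i
    proof -
      have "\<bar>real_of_int \<lfloor>4 * m * b i\<rfloor> - 4 * m * b i\<bar> \<le> 1" by linarith
      then have "\<bar>real_of_int \<lfloor>4 * m * b i\<rfloor> - 4 * m * b i\<bar> / (4 * m) \<le> 1 / (4 * m)"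
        by (intro divide_right_mono) auto
      also have "\<bar>real_of_int \<lfloor>4 * m * b i\<rfloor> - 4 * m * b i\<bar> / (4 * m) = \<bar>\<gamma> i - b i\<bar>"
      proof -
        have "\<gamma> i - b i = (real_of_int \<lfloor>4 * m * b i\<rfloor> - 4 * m * b i) / (4 * m)"
          using m by (simp add: \<gamma>_def diff_divide_distrib)
        then show ?thesis by (simp add: abs_divide)
      qed
      finally show ?thesis .
    qed
    obtain xs where xs: "set xs = S - {e}" "distinct xs"
      using finite_distinct_list[of "S - {e}"] finS by blast
    have len: "length xs < m"
      using distinct_card[OF xs(2)] card_Diff1_less[OF finS S(3)] xs(1) S(2) by simp
    define as where "as = map (\<lambda>i. (i, \<gamma> i)) xs @ replicate (m - length xs) (e, 0)"
    have "set as \<subseteq> I \<times> G" using xs S \<gamma>G G(2) by (auto simp: as_def)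
    moreover have "length as = m" using len by (simp add: as_def)
    ultimately have "1 / 2 \<le> norm (x e + (\<Sum>(i, \<gamma>)\<leftarrow>as. if i = e then 0 else \<gamma> *\<^sub>R x i))"
      using sep S by blast
    also have "(\<Sum>(i, \<gamma>)\<leftarrow>as. if i = e then 0 else \<gamma> *\<^sub>R x i) = (\<Sum>i\<leftarrow>xs. if i = e then 0 else \<gamma> i *\<^sub>R x i)"
    proof -
      have "sum_list (replicate k (0 :: 'a)) = 0" for k by (induction k) auto
      then show ?thesis by (simp add: as_def comp_def)
    qed
    also have "\<dots> = (\<Sum>i\<in>S - {e}. if i = e then 0 else \<gamma> i *\<^sub>R x i)"
      using xs by (simp add: sum_list_distinct_conv_sum_set)
    also have "\<dots> = (\<Sum>i\<in>S - {e}. \<gamma> i *\<^sub>R x i)" by (intro sum.cong) auto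
    also have "\<dots> = (\<Sum>i\<in>S - {e}. b i *\<^sub>R x i) + (\<Sum>i\<in>S - {e}. (\<gamma> i - b i) *\<^sub>R x i)"
      by (simp add: scaleR_left_diff_distrib sum_subtractf)
    also have "norm (x e + \<dots>) \<le> norm (x e + (\<Sum>i\<in>S - {e}. b i *\<^sub>R x i)) + norm (\<Sum>i\<in>S - {e}. (\<gamma> i - b i) *\<^sub>R x i)"
      unfolding add.assoc[symmetric] by (rule norm_triangle_ineq)
    also have "norm (\<Sum>i\<in>S - {e}. (\<gamma> i - b i) *\<^sub>R x i) \<le> (\<Sum>i\<in>S - {e}. 1 / (4 * m) * 1)"
    proof (rule sum_norm_le)
      fix i assume "i \<in> S - {e}"
      then have "norm (x i) \<le> 1" using x S(1) by blast
      then show "norm ((\<gamma> i - b i) *\<^sub>R x i) \<le> 1 / (4 * m) * 1"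
        unfolding norm_scaleR using \<gamma>b[of i] by (intro mult_mono) auto
    qed
    also have "\<dots> \<le> m * (1 / (4 * m))"
          proof -
      have "card (S - {e}) \<le> m" using S(2) card_Diff1_le[of S e] by linarith
      then have "real (card (S - {e})) * (1 / (4 * m)) \<le> real m * (1 / (4 * m))"
        by (intro mult_right_mono) auto
      then show ?thesis by simp
    qed
    also have "\<dots> = 1 / 4" using m by simp
    finally show ?thesis by simp
  qed
  show thesis
  proof (rule that[of x])
    fix S and a :: "'i \<Rightarrow> real" and e R assume S: "S \<subseteq> I" "card S \<le> m" "e \<in> S" "\<bar>a e\<bar> = R" "\<And>i. i \<in> S \<Longrightarrow> \<bar>a i\<bar> \<le> R"
    have finS: "finite S" using S(1) I finite_subset by blast
    show "R / 4 \<le> norm (\<Sum>i\<in>S. a i *\<^sub>R x i)"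
    proof (cases "R = 0")
      case False
      then have ae: "a e \<noteq> 0" "0 < R" using S(4) by auto
      have "1 / 4 \<le> norm (x e + (\<Sum>i\<in>S - {e}. (a i / a e) *\<^sub>R x i))"
        by (rule unit[OF S(1-3)]) (use S(4,5) ae in \<open>auto simp: abs_divide\<close>)
      then have "R / 4 \<le> \<bar>a e\<bar> * norm (x e + (\<Sum>i\<in>S - {e}. (a i / a e) *\<^sub>R x i))"
        using ae S(4) by (simp add: field_simps)
      also have "\<dots> = norm (a e *\<^sub>R (x e + (\<Sum>i\<in>S - {e}. (a i / a e) *\<^sub>R x i)))" by simp
      also have "a e *\<^sub>R (x e + (\<Sum>i\<in>S - {e}. (a i / a e) *\<^sub>R x i)) = a e *\<^sub>R x e + (\<Sum>i\<in>S - {e}. a i *\<^sub>R x i)"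
        using ae by (simp add: scaleR_add_right scaleR_sum_right)
      also have "\<dots> = (\<Sum>i\<in>S. a i *\<^sub>R x i)" by (rule sum.remove[OF finS S(3), symmetric])
      finally show ?thesis .
    qed simp
  qed (use x in auto)
qed

section \<open>The shortest path metric of the weighted diamonds\<close>

lemma finite_verts: "finite (pverts (weighted_diamond n))"
  by (simp add: weighted_diamond_def diamond_def finite_Field finite_diamond_edges)

text \<open>
  The parameter is the ratio \<open>w = 1/2 + \<epsilon>\<close> of the weights of consecutive levels.
\<close>

locale diamond_metric =
  fixes w :: real and n :: nat
  assumes w: "1 / 2 < w" "w < 1"
begin

interpretation pair_graph "weighted_diamond n" by (rule pair_graph_weighted_diamond)

abbreviation "d \<equiv> weighted_diamond_dist (w - 1 / 2) n"
abbreviation "wt \<equiv> diamond_weight (w - 1 / 2)"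
abbreviation "V \<equiv> pverts (weighted_diamond n)"

lemma w_bounds: "0 < w" "w < 1" using w by auto

lemma eps: "0 < w - 1 / 2"
  using w by simp

lemma dist_le_walk_cost:
  assumes "awalk x p y"
  shows "d x y \<le> awalk_cost (wt) p"
proof -
  have "x \<in> V" "y \<in> V" using awalk_hd_in_verts[OF assms] awalk_last_in_verts[OF assms] by simp_all
  then show ?thesis
    using min_cost_le_walk_cost[OF assms, of "wt"]
      weighted_diamond_dist_finite[OF eps, of x n y] by simp
qed

lemma obtain_walk_cost_less:
  assumes "x \<in> V" "y \<in> V" "d x y < r"
  obtains p where "awalk x p y" "awalk_cost (wt) p < r"
proof -
  have "\<mu> (wt) x y < ereal r"
    using weighted_diamond_dist_finite[OF eps assms(1,2)] assms(3) by simp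
  then show thesis unfolding \<mu>_def INF_less_iff using that by auto
qed

lemma dist_triangle_le:
  assumes "x \<in> V" "y \<in> V" "z \<in> V"
  shows "d x z \<le> d x y + d y z"
proof (rule field_le_epsilon)
  fix r :: real assume r: "0 < r"
  obtain p where p: "awalk x p y" "awalk_cost (wt) p < d x y + r / 2"
    using obtain_walk_cost_less[OF assms(1,2), of "d x y + r / 2"] r by auto
  obtain q where q: "awalk y q z" "awalk_cost (wt) q < d y z + r / 2"
    using obtain_walk_cost_less[OF assms(2,3), of "d y z + r / 2"] r by auto
  have "d x z \<le> awalk_cost (wt) (p @ q)"
    by (rule dist_le_walk_cost) (use p q in \<open>auto intro: awalk_appendI\<close>)
  then show "d x z \<le> d x y + d y z + r" using p q by simp
qed

lemma dist_commute_diamond: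
  assumes "x \<in> V" "y \<in> V"
  shows "d x y = d y x"
proof -
  have sym: "wt (prod.swap e) = wt e" for e
    unfolding diamond_weight_def by (cases e) (simp add: diamond_def disj_commute)
  have rev: "\<exists>q. awalk v q u \<and> awalk_cost (wt) q = awalk_cost (wt) p"
    if "awalk u p v" for u v p
    using that
  proof (induction p arbitrary: u)
    case (Cons e p)
    then have e: "e \<in> parcs (weighted_diamond n)" "fst e = u" and p: "awalk (snd e) p v"
      by (auto simp: awalk_Cons_iff)
    from Cons.IH[OF p] obtain q where q: "awalk v q (snd e)"
      "awalk_cost (wt) q = awalk_cost (wt) p" by blast
    have "prod.swap e \<in> parcs (weighted_diamond n)"
      using e by (cases e) (auto simp: weighted_diamond_def diamond_def)
    then have "awalk (snd e) [prod.swap e] u"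
      using arc_implies_awalk[of "prod.swap e"] e by simp
    with q have "awalk v (q @ [prod.swap e]) u" by (rule_tac awalk_appendI)
    with q sym show ?case by (intro exI[of _ "q @ [prod.swap e]"]) (simp add: sym)
  qed (auto intro!: exI[of _ "[]"] simp: awalk_Nil_iff)
  have "d u v \<le> d v u" if uv: "u \<in> V" "v \<in> V" for u v
  proof (rule ccontr)
    assume "\<not> d u v \<le> d v u"
    with obtain_walk_cost_less[OF uv(2,1), of "d u v"] obtain p
      where "awalk v p u" "awalk_cost (wt) p < d u v" by auto
    with rev[of v p u] dist_le_walk_cost show False by (metis not_le)
  qed
  from this[OF assms] this[OF assms(2,1)] show ?thesis by simp
qed

lemma dist_self_le: "x \<in> V \<Longrightarrow> d x x \<le> 0"
  using dist_le_walk_cost[of x "[]" x] by (simp add: awalk_Nil_iff)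

lemma dist_edge_le:
  assumes e: "e \<in> diamond_edges i" and "i \<le> n"
  shows "d (fst e) (snd e) \<le> w ^ i"
proof -
  have i: "e \<in> parcs (diamond i)" using e by (simp add: diamond_def)
  then have "e \<in> parcs (weighted_diamond n)"
    using \<open>i \<le> n\<close> by (auto simp: weighted_diamond_def)
  then have "awalk (fst e) [e] (snd e)" using arc_implies_awalk[of e] by simp
  from dist_le_walk_cost[OF this] show ?thesis by (simp add: diamond_weight_eq[OF i])
qed

text \<open>
  A walk of total cost less than \<open>D\<close> uses only edges of weight less than \<open>D\<close>, so that a map needs
  to be Lipschitz on such edges only in order to be so at distances below \<open>D\<close>.
\<close>

lemma lipschitz_on_short_edges:
  fixes F :: "vertex \<Rightarrow> 'b::metric_space"
  assumes "x \<in> V" "y \<in> V" and D: "d x y < D" and lam: "0 \<le> \<kappa>"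
    and edge: "\<And>e l. e \<in> diamond_edges l \<Longrightarrow> l \<le> n \<Longrightarrow> w ^ l < D \<Longrightarrow>
      dist (F (fst e)) (F (snd e)) \<le> \<kappa> * w ^ l"
  shows "dist (F x) (F y) \<le> \<kappa> * d x y"
proof -
  have nonneg: "0 \<le> awalk_cost (wt) p" for p
    using w by (auto simp: awalk_cost_def diamond_weight_def intro!: sum_list_nonneg)
  have walk: "dist (F u) (F v) \<le> \<kappa> * awalk_cost (wt) p"
    if "awalk u p v" "awalk_cost (wt) p < D" for u v p
    using that
  proof (induction p arbitrary: u)
    case (Cons e p)
    then have e: "e \<in> parcs (weighted_diamond n)" "fst e = u" and p: "awalk (snd e) p v"
      by (auto simp: awalk_Cons_iff)
    from e(1) obtain l where l: "l \<le> n" "e \<in> parcs (diamond l)"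
      by (auto simp: weighted_diamond_def)
    have wt: "wt e = w ^ l" using diamond_weight_eq[OF l(2)] by simp
    have wpos: "0 \<le> w ^ l" using w by simp
    have less: "w ^ l < D" "awalk_cost (wt) p < D"
      using Cons.prems(2) nonneg[of p] wt wpos by auto
    have "dist (F (fst e)) (F (snd e)) \<le> \<kappa> * w ^ l"
    proof (cases "e \<in> diamond_edges l")
      case False
      with l(2) have "prod.swap e \<in> diamond_edges l" by (auto simp: diamond_def)
      from edge[OF this l(1) less(1)] show ?thesis by (simp add: dist_commute)
    qed (use edge l(1) less(1) in blast)
    moreover have "dist (F (snd e)) (F v) \<le> \<kappa> * awalk_cost (wt) p"
      by (rule Cons.IH[OF p less(2)])
    ultimately have "dist (F u) (F v) \<le> \<kappa> * w ^ l + \<kappa> * awalk_cost (wt) p"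
      using dist_triangle[of "F u" "F v" "F (snd e)"] e(2) by simp
    then show ?case by (simp add: wt algebra_simps)
  qed (auto simp: awalk_Nil_iff)
  show ?thesis
  proof (rule ccontr)
    assume "\<not> dist (F x) (F y) \<le> \<kappa> * d x y"
    then have less: "\<kappa> * d x y < dist (F x) (F y)" by simp
    define r where "r = (if \<kappa> = 0 then D else min D (dist (F x) (F y) / \<kappa>))"
    have "d x y < r" using less lam D by (auto simp: r_def field_simps)
    then obtain p where p: "awalk x p y" "awalk_cost (wt) p < r"
      using obtain_walk_cost_less[OF assms(1,2)] by blast
    then have "awalk_cost (wt) p < D" by (auto simp: r_def split: if_splits)
    from walk[OF p(1) this] less p(2) lam show False
      by (auto simp: r_def field_simps split: if_splits)
  qed
qed

lemma dist_pos:
  assumes "x \<in> V" "y \<in> V" "x \<noteq> y"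
  shows "0 < d x y"
proof -
  define F :: "vertex \<Rightarrow> real" where "F z = (if z = x then 1 else 0)" for z
  define \<kappa> where "\<kappa> = 1 / w ^ n"
  have pos: "0 < w ^ n" using w by simp
  have "dist (F x) (F y) \<le> \<kappa> * d x y"
  proof (rule lipschitz_on_short_edges[OF assms(1,2), of "d x y + 1"])
    fix e l assume "l \<le> n"
    then have "w ^ n \<le> w ^ l"
      using w by (intro power_decreasing) auto
    then have "1 \<le> \<kappa> * w ^ l" using pos by (simp add: \<kappa>_def field_simps)
    moreover have "dist (F (fst e)) (F (snd e)) \<le> 1" by (simp add: F_def dist_real_def)
    ultimately show "dist (F (fst e)) (F (snd e)) \<le> \<kappa> * w ^ l" by linarith
  qed (use pos in \<open>auto simp: \<kappa>_def\<close>)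
  then have "1 \<le> \<kappa> * d x y" using assms(3) by (simp add: F_def)
  moreover have "0 < \<kappa>" using pos by (simp add: \<kappa>_def)
  ultimately show ?thesis using zero_less_mult_pos[of \<kappa> "d x y"] by simp
qed

end

section \<open>Coordinates of the vertices\<close>

text \<open>
  The four edges that replace \<open>e\<close>: the flag \<open>s\<close> selects the new vertex, and \<open>h\<close> the end of \<open>e\<close> to
  which it is joined (\<open>fst e\<close> if false). The orientation of the quadrilateral is \<open>u, a, v, b\<close>, so that
  an edge starts at the end of \<open>e\<close> if and only if \<open>s = h\<close>.
\<close>

definition child_edge :: "vertex \<times> vertex \<Rightarrow> bool \<Rightarrow> bool \<Rightarrow> vertex \<times> vertex" where
  "child_edge e s h =
    (let z = if h then snd e else fst e; m = New (fst e) (snd e) s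
     in if s = h then (z, m) else (m, z))"

lemma diamond_edges_Suc: "diamond_edges (Suc n) = {child_edge e s h | e s h. e \<in> diamond_edges n}"
proof -
  have "(let a = New u v False; b = New u v True in {(u, a), (a, v), (v, b), (b, u)}) =
      {child_edge (u, v) s h | s h. True}" for u v
    unfolding child_edge_def Let_def by (auto simp: ex_bool_eq)
  then show ?thesis by (fastforce simp: case_prod_unfold)
qed

definition lev :: "vertex \<times> vertex \<Rightarrow> nat" where
  "lev e = max (vertex_depth (fst e)) (vertex_depth (snd e))"

lemma lev_diamond_edge: "e \<in> diamond_edges i \<Longrightarrow> lev e = i"
  using diamond_edges_depth[of "fst e" "snd e" i] by (simp add: lev_def)

lemma diamond_edge_ne: "e \<in> diamond_edges i \<Longrightarrow> fst e \<noteq> snd e"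
  using diamond_edges_depth[of "fst e" "snd e" i] by simp

text \<open>
  The coordinates of the vertices. The index \<open>(Src, Src)\<close>, which is not an edge, stands for the
  direction from \<open>Src\<close> to \<open>Snk\<close> and gives the position of a vertex between the two. An edge is the
  index of a tent-shaped function that vanishes outside of the part of the graph that replaces the
  edge, and has opposite signs on the two sides of the quadrilateral.
\<close>

primrec coef :: "real \<Rightarrow> vertex \<times> vertex \<Rightarrow> vertex \<Rightarrow> real" where
  "coef w e Src = 0"
| "coef w e Snk = (if e = (Src, Src) then 1 else 0)"
| "coef w e (New u v s) = (coef w e u + coef w e v) / 2 +
    (if e = (u, v) then (if s then - 1 else 1) * w ^ lev e else 0)"

lemma coef_eq_0:
  assumes "vertex_depth x \<le> lev e" "x \<noteq> Snk \<or> e \<noteq> (Src, Src)"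
  shows "coef w e x = 0"
  using assms
proof (induction x)
  case (New u v s)
  have "e \<noteq> (u, v)" using New.prems(1) by (auto simp: lev_def)
  moreover have "vertex_depth u < lev e" "vertex_depth v < lev e"
    using New.prems(1) by auto
  moreover from this have "e \<noteq> (Src, Src)" by (auto simp: lev_def)
  ultimately show ?case using New.IH by simp
qed auto

lemma coef_ends_eq_0: "coef w e (fst e) = 0" "coef w e (snd e) = 0"
  by (rule coef_eq_0; auto simp: lev_def)+

lemma abs_coef_le:
  assumes "0 \<le> w"
  shows "\<bar>coef w e x\<bar> \<le> w ^ lev e"
proof (induction x)
  case (New u v s)
  show ?case
  proof (cases "e = (u, v)")
    case True
    then show ?thesis using coef_ends_eq_0[of w e] assms by simp
  qed (use New.IH in \<open>simp add: abs_le_iff\<close>)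
qed (use assms in \<open>auto simp: lev_def\<close>)

text \<open>
  The cell of an edge \<open>e\<close> consists of its ends and the vertices created from it in \<open>k\<close> steps. The predicate says
  that \<open>x\<close> belongs to it, at relative position \<open>t\<close> between \<open>fst e\<close> (0) and \<open>snd e\<close> (1). In the
  recursion, \<open>r\<close> is the position of \<open>x\<close> between an end of \<open>e\<close> (0) and one of the two new vertices (1).
\<close>

fun cell_pos :: "nat \<Rightarrow> vertex \<times> vertex \<Rightarrow> real \<Rightarrow> vertex \<Rightarrow> bool" where
  "cell_pos 0 e t x \<longleftrightarrow> x = fst e \<and> t = 0 \<or> x = snd e \<and> t = 1"
| "cell_pos (Suc k) e t x \<longleftrightarrow> (\<exists>s h r. t = (if h then 1 - r / 2 else r / 2) \<and>
    cell_pos k (child_edge e s h) (if s = h then r else 1 - r) x)"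

lemma cell_pos_range: "cell_pos k e t x \<Longrightarrow> 0 \<le> t \<and> t \<le> 1"
proof (induction k arbitrary: e t)
  case (Suc k)
  then obtain s h r where "t = (if h then 1 - r / 2 else r / 2)"
    "cell_pos k (child_edge e s h) (if s = h then r else 1 - r) x" by auto
  with Suc.IH[of "child_edge e s h" "if s = h then r else 1 - r"] show ?case
    by (auto split: if_splits)
qed auto

lemma child_edge_in: "e \<in> diamond_edges i \<Longrightarrow> child_edge e s h \<in> diamond_edges (Suc i)"
  unfolding diamond_edges_Suc by blast

text \<open>
  The end of greater depth of an edge is a new vertex, whose name contains the edge that was
  replaced.
\<close>

definition parent_edge :: "vertex \<times> vertex \<Rightarrow> vertex \<times> vertex" where
  "parent_edge e = (case (if vertex_depth (fst e) > vertex_depth (snd e) then fst e else snd e) of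
     New u v s \<Rightarrow> (u, v) | _ \<Rightarrow> e)"

lemma parent_child_edge: "parent_edge (child_edge e s h) = e"
  by (auto simp: parent_edge_def child_edge_def Let_def split: vertex.splits)

lemma child_edge_eq_iff:
  assumes "fst e \<noteq> snd e"
  shows "child_edge e s h = child_edge e s' h' \<longleftrightarrow> s = s' \<and> h = h'"
proof -
  have "vertex_depth (New u v c) \<noteq> vertex_depth u" "vertex_depth (New u v c) \<noteq> vertex_depth v" for u v c
    by simp_all
  then have *: "u \<noteq> New u v c" "v \<noteq> New u v c" "New u v c \<noteq> u" "New u v c \<noteq> v" for u v c
    by metis+
  show ?thesis
    using assms by (cases e; cases s; cases h; cases s'; cases h') (simp_all add: child_edge_def *)
qed

text \<open>
  A function that takes at new vertices the mean of its values at the ends of the replaced edge is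
  affine in the position. Below, this is applied to coordinates of coarser levels.
\<close>

lemma cell_pos_interpolation:
  fixes F :: "vertex \<Rightarrow> real"
  assumes "cell_pos k e t x" "e \<in> diamond_edges i"
    and "\<And>e l s. i \<le> l \<Longrightarrow> e \<in> diamond_edges l \<Longrightarrow> F (New (fst e) (snd e) s) = (F (fst e) + F (snd e)) / 2"
  shows "F x = (1 - t) * F (fst e) + t * F (snd e)"
  using assms
proof (induction k arbitrary: e t i)
  case (Suc k)
  then obtain s h r where t: "t = (if h then 1 - r / 2 else r / 2)"
    and x: "cell_pos k (child_edge e s h) (if s = h then r else 1 - r) x" by auto
  let ?m = "New (fst e) (snd e) s" and ?z = "if h then snd e else fst e"
  have m: "F ?m = (F (fst e) + F (snd e)) / 2" using Suc.prems by blast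
  have "F x = (1 - r) * F ?z + r * F ?m"
    using Suc.IH[OF x child_edge_in[OF Suc.prems(2)] Suc.prems(3)[OF Suc_leD]]
    by (cases "s = h") (simp_all add: child_edge_def Let_def algebra_simps)
  then have "F x = (1 - r) * F ?z + r * ((F (fst e) + F (snd e)) / 2)"
    by (simp only: m)
  then show ?case unfolding t by (cases h) (simp_all add: field_simps)
qed auto

lemma cell_pos_child:
  assumes "cell_pos k (child_edge e s h) t x"
  shows "\<exists>t. cell_pos (Suc k) e t x"
  using assms unfolding cell_pos.simps
  by (intro exI[of _ "if h then 1 - (if s = h then t else 1 - t) / 2 else (if s = h then t else 1 - t) / 2"]
      exI[of _ s] exI[of _ h] exI[of _ "if s = h then t else 1 - t"]) auto

lemma diamond_edges_relpow:
  "diamond_edges n = {e. ((Src, Snk), e) \<in> {(e, child_edge e s h) | e s h. True} ^^ n}"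
proof (induction n)
  case (Suc n)
  show ?case unfolding diamond_edges_Suc Suc.IH relpow.simps by blast
qed auto

lemma cell_pos_exists:
  assumes "x \<in> pverts (diamond n)"
  shows "\<exists>t. cell_pos n (Src, Snk) t x"
proof -
  let ?R = "{(e, child_edge e s h) | e s h. True}"
  have "\<exists>t. cell_pos k e t x" if "(e, e') \<in> ?R ^^ k" "x = fst e' \<or> x = snd e'" for k e e'
    using that
  proof (induction k arbitrary: e)
    case (Suc k)
    then obtain s h where "(child_edge e s h, e') \<in> ?R ^^ k"
      using relpow_Suc_D2[OF Suc.prems(1)] by blast
    then show ?case using Suc.IH Suc.prems(2) cell_pos_child by blast
  qed auto
  moreover obtain e where "e \<in> diamond_edges n" "x = fst e \<or> x = snd e"
    using assms by (force simp: diamond_def Field_def)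
  ultimately show ?thesis using diamond_edges_relpow by blast
qed

text \<open>
  On a child cell the coordinate of \<open>e\<close> is affine: it runs from 0 at the end of \<open>e\<close> to \<open>\<plusminus> w\<^sup>i\<close> at the
  new vertex.
\<close>

lemma coef_cell:
  assumes e: "e \<in> diamond_edges i" and x: "cell_pos k (child_edge e s h) (if s = h then r else 1 - r) x"
  shows "coef w e x = (if s then - 1 else 1) * w ^ i * r"
proof -
  have lev: "lev e = i" using e by (rule lev_diamond_edge)
  have "coef w e x = (1 - (if s = h then r else 1 - r)) * coef w e (fst (child_edge e s h)) +
      (if s = h then r else 1 - r) * coef w e (snd (child_edge e s h))"
  proof (rule cell_pos_interpolation[OF x child_edge_in[OF e]])
    fix e' l c assume "Suc i \<le> l" "e' \<in> diamond_edges l"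
    then have "e \<noteq> e'" using lev lev_diamond_edge by fastforce
    then show "coef w e (New (fst e') (snd e') c) = (coef w e (fst e') + coef w e (snd e')) / 2"
      by simp
  qed
  then show ?thesis using lev coef_ends_eq_0[of w e]
    by (cases e) (auto simp: child_edge_def Let_def)
qed

text \<open>
  A nonzero coordinate at \<open>x\<close> of a level that is not coarser than \<open>e\<close> belongs to a descendant of \<open>e\<close>.
  In particular, points of different cells of the same level have no such coordinate in common.
\<close>

lemma coef_support:
  assumes "cell_pos k e t x" "e \<in> diamond_edges i" "e' \<in> diamond_edges l" "i \<le> l"
    "coef w e' x \<noteq> 0"
  shows "(parent_edge ^^ (l - i)) e' = e"
  using assms
proof (induction k arbitrary: e t i)
  case 0
  have "vertex_depth x \<le> lev e" using 0(1) by (auto simp: lev_def)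
  then have "vertex_depth x \<le> lev e'" using 0(4) lev_diamond_edge[OF 0(2)] lev_diamond_edge[OF 0(3)] by simp
  moreover have "e' \<noteq> (Src, Src)" using diamond_edge_ne[OF 0(3)] by auto
  ultimately show ?case using coef_eq_0 0(5) by blast
next
  case (Suc k)
  then obtain s h r where x: "cell_pos k (child_edge e s h) (if s = h then r else 1 - r) x" by auto
  show ?case
  proof (cases "l = i")
    case True
    have "e' = e"
    proof (rule ccontr)
      assume ne: "e' \<noteq> e"
      have lev: "lev e' = i" "lev e = i" using Suc.prems True lev_diamond_edge by auto
      have root: "e' \<noteq> (Src, Src)" using diamond_edge_ne[OF Suc.prems(3)] by auto
      have "coef w e' x = (1 - (if s = h then r else 1 - r)) * coef w e' (fst (child_edge e s h)) +
          (if s = h then r else 1 - r) * coef w e' (snd (child_edge e s h))"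
      proof (rule cell_pos_interpolation[OF x child_edge_in[OF Suc.prems(2)]])
        fix a j c assume "Suc i \<le> j" "a \<in> diamond_edges j"
        then have "e' \<noteq> a" using lev lev_diamond_edge by fastforce
        then show "coef w e' (New (fst a) (snd a) c) = (coef w e' (fst a) + coef w e' (snd a)) / 2"
          by simp
      qed
      moreover have "coef w e' (fst e) = 0" "coef w e' (snd e) = 0"
        by (rule coef_eq_0; use lev root in \<open>auto simp: lev_def\<close>)+
      ultimately have "coef w e' x = 0"
        using ne by (cases e) (auto simp: child_edge_def Let_def)
      with Suc.prems(5) show False by simp
    qed
    with True show ?thesis by simp
  next
    case False
    with Suc.prems(4) have "Suc i \<le> l" by simp
    from Suc.IH[OF x child_edge_in[OF Suc.prems(2)] Suc.prems(3) this Suc.prems(5)]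
    have "(parent_edge ^^ (l - Suc i)) e' = child_edge e s h" .
    moreover have "l - i = Suc (l - Suc i)" using \<open>Suc i \<le> l\<close> by simp
    ultimately show ?thesis by (simp add: parent_child_edge)
  qed
qed

section \<open>The distance is bounded by the largest difference of coordinates\<close>

context diamond_metric
begin

lemma ends_in_V: "e \<in> diamond_edges i \<Longrightarrow> i \<le> n \<Longrightarrow> fst e \<in> V \<and> snd e \<in> V"
  using diamond_verts_mono[of i n]
  by (cases e) (auto simp: weighted_diamond_def diamond_def Field_def)

lemma mid_in_V: "e \<in> diamond_edges i \<Longrightarrow> i < n \<Longrightarrow> New (fst e) (snd e) s \<in> V"
  using diamond_verts_mono[of "Suc i" n] diamond_verts_Suc[of i]
  by (cases e) (auto simp: weighted_diamond_def)

lemma cell_pos_in_V: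
  assumes "cell_pos k e t x" "e \<in> diamond_edges i" "i + k = n"
  shows "x \<in> V"
  using assms
proof (induction k arbitrary: e t i)
  case 0
  then show ?case using ends_in_V[of e i] by auto
next
  case (Suc k)
  then obtain s h r where x: "cell_pos k (child_edge e s h) (if s = h then r else 1 - r) x" by auto
  with Suc.IH[OF x child_edge_in[OF Suc.prems(2)]] Suc.prems(3) show ?case by simp
qed

text \<open>
  Descending through the levels costs at most \<open>w\<^sup>i + w\<^bsup>i+1\<^esup> + \<dots> = w\<^sup>i / (1 - w)\<close>.
\<close>

lemma cell_dist_ends_le:
  assumes "cell_pos k e t x" "e \<in> diamond_edges i" "i + k = n"
  shows "d x (fst e) \<le> w ^ i / (1 - w) \<and> d x (snd e) \<le> w ^ i / (1 - w)"
  using assms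
proof (induction k arbitrary: e t i)
  case 0
  have V: "fst e \<in> V" "snd e \<in> V" using ends_in_V[OF 0(2)] 0(3) by auto
  have "d (fst e) (snd e) \<le> w ^ i" using dist_edge_le[OF 0(2)] 0(3) by simp
  moreover have "w ^ i \<le> w ^ i / (1 - w)" "0 \<le> w ^ i / (1 - w)"
    using w_bounds by (auto simp: field_simps)
  moreover have "x = fst e \<or> x = snd e" using 0(1) by auto
  ultimately show ?case
    using V dist_self_le[of "fst e"] dist_self_le[of "snd e"] dist_commute_diamond[of "fst e" "snd e"]
    by auto
next
  case (Suc k)
  then obtain s h r where x: "cell_pos k (child_edge e s h) (if s = h then r else 1 - r) x" by auto
  define z where "z = (if h then snd e else fst e)"
  have xV: "x \<in> V" by (rule cell_pos_in_V[OF Suc.prems])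
  have V: "fst e \<in> V" "snd e \<in> V" using ends_in_V[OF Suc.prems(2)] Suc.prems(3) by auto
  have xz: "d x z \<le> w ^ Suc i / (1 - w)"
    using Suc.IH[OF x child_edge_in[OF Suc.prems(2)]] Suc.prems(3)
    by (cases "s = h") (simp_all add: child_edge_def Let_def z_def)
  have zy: "d z y \<le> w ^ i" if "y = fst e \<or> y = snd e" for y
    using that dist_edge_le[OF Suc.prems(2)] Suc.prems(3) V dist_self_le[of "fst e"]
      dist_self_le[of "snd e"] dist_commute_diamond[of "fst e" "snd e"]
      zero_less_power[OF w_bounds(1), of i]
    by (auto simp: z_def)
  have "d x y \<le> w ^ i / (1 - w)" if y: "y = fst e \<or> y = snd e" for y
  proof -
    have "d x y \<le> d x z + d z y"
      by (rule dist_triangle_le) (use y V xV in \<open>auto simp: z_def\<close>)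
    also have "\<dots> \<le> w ^ Suc i / (1 - w) + w ^ i" by (intro add_mono xz zy y)
    also have "\<dots> = w ^ i / (1 - w)" using w_bounds by (simp add: field_simps)
    finally show ?thesis .
  qed
  then show ?case by simp
qed

text \<open>
  Descend from \<open>e\<close> towards the end that is close to \<open>x\<close>, as long as \<open>x\<close> stays in the quarter next to
  that end. In the last cell of level \<open>i\<close> that is reached, the tent function of the cell is at least
  half its maximum at \<open>x\<close>, so that \<open>w\<^sup>i\<close> is at most \<open>2 R\<close>, whereas the distance to the end is of the order
  of \<open>w\<^sup>i\<close>.
\<close>

lemma near_end_dist_le:
  assumes "cell_pos k e t x" "e \<in> diamond_edges i" "i + k = n"
    and R: "0 \<le> R" "\<And>e' l. i \<le> l \<Longrightarrow> l < n \<Longrightarrow> e' \<in> diamond_edges l \<Longrightarrow> \<bar>coef w e' x\<bar> \<le> R"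
  shows "(t \<le> 1 / 2 \<longrightarrow> d x (fst e) \<le> 2 * R / (1 - w)) \<and> (1 / 2 \<le> t \<longrightarrow> d x (snd e) \<le> 2 * R / (1 - w))"
  using assms
proof (induction k arbitrary: e t i)
  case 0
  have V: "fst e \<in> V" "snd e \<in> V" using ends_in_V[OF 0(2)] 0(3) by auto
  moreover have "0 \<le> 2 * R / (1 - w)" using w_bounds 0(4) by simp
  ultimately show ?case
    using 0(1) dist_self_le[of "fst e"] dist_self_le[of "snd e"] by auto
next
  case (Suc k)
  then obtain s h r where t: "t = (if h then 1 - r / 2 else r / 2)"
    and x: "cell_pos k (child_edge e s h) (if s = h then r else 1 - r) x" by auto
  show ?case
  proof (cases "r < 1 / 2")
    case True
    have "Suc i + k = n" using Suc.prems(3) by simp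
    note IH = Suc.IH[OF x child_edge_in[OF Suc.prems(2)] this Suc.prems(4) Suc.prems(5)[OF Suc_leD]]
    have "d x (if h then snd e else fst e) \<le> 2 * R / (1 - w)"
      using IH True by (cases "s = h") (simp_all add: child_edge_def Let_def)
    with t True show ?thesis by auto
  next
    case False
    have "\<bar>coef w e x\<bar> \<le> R" by (rule Suc.prems(5)) (use Suc.prems(2,3) in auto)
    moreover have "w ^ i * (1 / 2) \<le> w ^ i * r"
      using False w_bounds by (intro mult_left_mono) auto
    ultimately have "w ^ i \<le> 2 * R"
      using coef_cell[OF Suc.prems(2) x, of w] by (cases s) auto
    then have "w ^ i / (1 - w) \<le> 2 * R / (1 - w)"
      using w_bounds by (simp add: divide_right_mono)
    with cell_dist_ends_le[OF Suc.prems(1-3)] show ?thesis by auto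
  qed
qed

text \<open>
  Descend to the smallest cell that contains \<open>x\<close> and \<open>y\<close>. The hypothesis on the positions is passed
  on to a child cell because there the coordinate of \<open>e\<close> is an affine function of the position. When
  \<open>x\<close> and \<open>y\<close> are in different children, either \<open>w\<^sup>i\<close> is at most \<open>4 R\<close>, and any two vertices of the
  cell have a distance of that order; or the positions differ by less than 1/4 and so do the tent
  functions, taken with their signs. Then \<open>x\<close> and \<open>y\<close> are both close to a common vertex of their two
  children, and \<open>near_end_dist_le\<close> applies to each of them, since no coordinate of a finer level is
  nonzero at both.
\<close>

lemma cell_dist_le_coef_diff:
  assumes "cell_pos k e t x" "cell_pos k e t' y" "e \<in> diamond_edges i" "i + k = n"
    and pos: "w ^ i * \<bar>t - t'\<bar> \<le> R"
    and R: "\<And>e' l. i \<le> l \<Longrightarrow> l < n \<Longrightarrow> e' \<in> diamond_edges l \<Longrightarrow> \<bar>coef w e' x - coef w e' y\<bar> \<le> R"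
  shows "d x y \<le> 8 * R / (1 - w)"
proof -
  have far: "d x y \<le> 8 * R / (1 - w)"
    if "cell_pos k e t x" "cell_pos k e t' y" "e \<in> diamond_edges i" "i + k = n" "w ^ i \<le> 4 * R" for k e t t' i
  proof -
    have "d x y \<le> d x (fst e) + d (fst e) y"
      using that ends_in_V[of e i] cell_pos_in_V by (intro dist_triangle_le) auto
    also have "d (fst e) y = d y (fst e)"
      using that ends_in_V[of e i] cell_pos_in_V by (intro dist_commute_diamond) auto
    also have "d x (fst e) + d y (fst e) \<le> 2 * w ^ i / (1 - w)"
      using cell_dist_ends_le[OF that(1,3,4)] cell_dist_ends_le[OF that(2,3,4)] by simp
    also have "\<dots> \<le> 8 * R / (1 - w)"
      using that(5) w_bounds by (intro divide_right_mono) auto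
    finally show ?thesis .
  qed
  show ?thesis using assms
  proof (induction k arbitrary: e t t' i)
    case 0
    have xV: "x \<in> V" by (rule cell_pos_in_V[OF 0(1,3,4)])
    show ?case
    proof (cases "t = t'")
      case True
      then have "x = y" using 0(1,2) by auto
      moreover have "0 \<le> 8 * R / (1 - w)" using True 0(5) w_bounds by simp
      ultimately show ?thesis using dist_self_le[OF xV] by simp
    next
      case False
      then have "\<bar>t - t'\<bar> = 1" using 0(1,2) by auto
      then have "w ^ i \<le> 4 * R" using 0(5) zero_less_power[OF w_bounds(1), of i] by simp
      with far[OF 0(1-4)] show ?thesis .
    qed
  next
    case (Suc k)
    from Suc.prems(1) obtain s h r where t: "t = (if h then 1 - r / 2 else r / 2)"
      and x: "cell_pos k (child_edge e s h) (if s = h then r else 1 - r) x" by auto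
    from Suc.prems(2) obtain s' h' r' where t': "t' = (if h' then 1 - r' / 2 else r' / 2)"
      and y: "cell_pos k (child_edge e s' h') (if s' = h' then r' else 1 - r') y" by auto
    have n: "Suc i + k = n" "i < n" using Suc.prems(4) by auto
    note child = child_edge_in[OF Suc.prems(3)]
    have r: "0 \<le> r" "r \<le> 1" "0 \<le> r'" "r' \<le> 1"
      using cell_pos_range[OF x] cell_pos_range[OF y] by (auto split: if_splits)
    have wi: "0 < w ^ i" using w_bounds by simp
    have e_diff: "\<bar>coef w e x - coef w e y\<bar> \<le> R"
      by (rule Suc.prems(6)) (use Suc.prems(3) n in auto)
    have R0: "0 \<le> R" using e_diff by linarith
    have cx: "coef w e x = (if s then - 1 else 1) * w ^ i * r"
      and cy: "coef w e y = (if s' then - 1 else 1) * w ^ i * r'"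
      using coef_cell[OF Suc.prems(3) x] coef_cell[OF Suc.prems(3) y] by auto
    show ?case
    proof (cases "s = s' \<and> h = h'")
      case True
      have "coef w e x - coef w e y = (if s then - 1 else 1) * w ^ i * (r - r')"
        using cx cy True by (simp add: algebra_simps)
      then have "w ^ i * \<bar>r - r'\<bar> \<le> R"
        using e_diff wi by (simp add: abs_mult split: if_splits)
      moreover have "w ^ Suc i * \<bar>r - r'\<bar> \<le> w ^ i * \<bar>r - r'\<bar>"
        using w_bounds by (intro mult_right_mono power_decreasing) auto
      ultimately have "w ^ Suc i * \<bar>(if s = h then r else 1 - r) - (if s = h then r' else 1 - r')\<bar> \<le> R"
        by (auto simp: abs_minus_commute)
      with Suc.IH[OF x _ child n(1) _ Suc.prems(6)[OF Suc_leD]] y True show ?thesis by auto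
    next
      case False
      have xV: "x \<in> V" by (rule cell_pos_in_V[OF x child n(1)])
      have yV: "y \<in> V" by (rule cell_pos_in_V[OF y child n(1)])
      have ne: "child_edge e s h \<noteq> child_edge e s' h'"
        using child_edge_eq_iff[OF diamond_edge_ne[OF Suc.prems(3)]] False by auto
      \<comment> \<open>Different children have no common descendant, so that a difference of two such coordinates
        is, up to the sign, one of them.\<close>
      have disj: "coef w e' x = 0 \<or> coef w e' y = 0"
        if "Suc i \<le> l" "e' \<in> diamond_edges l" for e' l
        using coef_support[OF x child that(2,1), of w] coef_support[OF y child that(2,1), of w] ne by metis
      have Rx: "\<bar>coef w e' x\<bar> \<le> R" and Ry: "\<bar>coef w e' y\<bar> \<le> R"
        if "Suc i \<le> l" "l < n" "e' \<in> diamond_edges l" for e' l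
        using disj[OF that(1,3)] Suc.prems(6)[of l e'] that R0 by auto
      let ?z = "if h then snd e else fst e" and ?z' = "if h' then snd e else fst e"
      let ?m = "New (fst e) (snd e) s" and ?m' = "New (fst e) (snd e) s'"
      have nx: "(r \<le> 1 / 2 \<longrightarrow> d x ?z \<le> 2 * R / (1 - w)) \<and> (1 / 2 \<le> r \<longrightarrow> d x ?m \<le> 2 * R / (1 - w))"
        using near_end_dist_le[OF x child n(1) R0 Rx]
        by (cases "s = h") (simp_all add: child_edge_def Let_def)
      have ny: "(r' \<le> 1 / 2 \<longrightarrow> d y ?z' \<le> 2 * R / (1 - w)) \<and> (1 / 2 \<le> r' \<longrightarrow> d y ?m' \<le> 2 * R / (1 - w))"
        using near_end_dist_le[OF y child n(1) R0 Ry]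
        by (cases "s' = h'") (simp_all add: child_edge_def Let_def)
      have via: "d x y \<le> 8 * R / (1 - w)"
        if "c \<in> V" "d x c \<le> 2 * R / (1 - w)" "d y c \<le> 2 * R / (1 - w)" for c
      proof -
        have "d x y \<le> d x c + d c y" by (rule dist_triangle_le[OF xV that(1) yV])
        also have "d c y = d y c" by (rule dist_commute_diamond[OF that(1) yV])
        also have "d x c + d y c \<le> 2 * (2 * R / (1 - w))" using that by simp
        also have "\<dots> \<le> 8 * R / (1 - w)" using R0 w_bounds by (simp add: divide_right_mono)
        finally show ?thesis .
      qed
      show ?thesis
      proof (cases "w ^ i \<le> 4 * R")
        case True
        with far[OF Suc.prems(1-4)] show ?thesis .
      next
        case less: False
        have tt: "\<bar>t - t'\<bar> < 1 / 4"
        proof (rule ccontr)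
          assume "\<not> ?thesis"
          then have "w ^ i * (1 / 4) \<le> w ^ i * \<bar>t - t'\<bar>" using wi by (intro mult_left_mono) auto
          with Suc.prems(5) less show False by simp
        qed
        show ?thesis
        proof (cases "s = s'")
          case True
          \<comment> \<open>Same side, different halves: both are close to the new vertex that the halves share.\<close>
          with False have "h \<noteq> h'" by simp
          then have "1 / 2 \<le> r" "1 / 2 \<le> r'" using tt t t' r by (auto simp: abs_if split: if_splits)
          with via[of ?m] nx ny mid_in_V[OF Suc.prems(3) n(2)] True show ?thesis by simp
        next
          \<comment> \<open>Opposite sides: the tent functions have different signs, so both are small, and both vertices
            are close to the same end of \<open>e\<close>.\<close>
          case opp: False
          have "w ^ i * (r + r') \<le> R" using e_diff opp unfolding cx cy by (cases s) (simp_all add: distrib_left)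
          have rr: "r + r' < 1 / 4"
          proof (rule ccontr)
            assume "\<not> ?thesis"
            then have "w ^ i * (1 / 4) \<le> w ^ i * (r + r')" using wi by (intro mult_left_mono) auto
            with \<open>w ^ i * (r + r') \<le> R\<close> less show False by simp
          qed
          then have "h = h'" using tt t t' r by (auto simp: abs_if split: if_splits)
          moreover have "?z \<in> V" using ends_in_V[OF Suc.prems(3)] n(2) by simp
          moreover have "r \<le> 1 / 2" "r' \<le> 1 / 2" using rr r by auto
          ultimately show ?thesis using via[of ?z] nx ny by simp
        qed
      qed
    qed
  qed
qed

text \<open>
  The coordinate of the root index is the position in the cell of the edge \<open>(Src, Snk)\<close>, which
  consists of all vertices.
\<close>

lemma dist_le_coef_diff:
  assumes "x \<in> V" "y \<in> V"
    and root: "\<bar>coef w (Src, Src) x - coef w (Src, Src) y\<bar> \<le> R"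
    and R: "\<And>e l. l < n \<Longrightarrow> e \<in> diamond_edges l \<Longrightarrow> \<bar>coef w e x - coef w e y\<bar> \<le> R"
  shows "d x y \<le> 8 * R / (1 - w)"
proof -
  have in_D: "x \<in> pverts (diamond n)" "y \<in> pverts (diamond n)"
    using assms by (simp_all add: weighted_diamond_def)
  obtain t t' where t: "cell_pos n (Src, Snk) t x" "cell_pos n (Src, Snk) t' y"
    using cell_pos_exists in_D by blast
  have pos: "coef w (Src, Src) z = c" if "cell_pos n (Src, Snk) c z" for c z
  proof -
    have "coef w (Src, Src) z =
        (1 - c) * coef w (Src, Src) (fst (Src, Snk)) + c * coef w (Src, Src) (snd (Src, Snk))"
    proof (rule cell_pos_interpolation[OF that, of 0])
      fix e l s assume "e \<in> diamond_edges l"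
      then have "(Src, Src) \<noteq> e" using diamond_edge_ne by fastforce
      then show "coef w (Src, Src) (New (fst e) (snd e) s) =
          (coef w (Src, Src) (fst e) + coef w (Src, Src) (snd e)) / 2" by simp
    qed simp
    then show ?thesis by simp
  qed
  have "w ^ 0 * \<bar>t - t'\<bar> \<le> R" using root pos[OF t(1)] pos[OF t(2)] by simp
  then show ?thesis using cell_dist_le_coef_diff[OF t, of 0 R] R by simp
qed

end

section \<open>Only few coordinates matter for a given pair of vertices\<close>

text \<open>
  On each level, only the ancestor of \<open>e\<close> can have a nonzero coordinate at an end of \<open>e\<close>.
\<close>

lemma coef_chain:
  assumes "e \<in> diamond_edges k"
  shows "\<exists>g. \<forall>e'. coef w e' (fst e) \<noteq> 0 \<or> coef w e' (snd e) \<noteq> 0 \<longrightarrow>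
    e' = (Src, Src) \<or> e' = g (lev e')"
  using assms
proof (induction k arbitrary: e)
  case 0
  then show ?case by auto
next
  case (Suc k)
  then obtain p s h where p: "p \<in> diamond_edges k" and e: "e = child_edge p s h"
    unfolding diamond_edges_Suc by blast
  from Suc.IH[OF p] obtain g where g: "\<And>e'. coef w e' (fst p) \<noteq> 0 \<or> coef w e' (snd p) \<noteq> 0 \<Longrightarrow>
      e' = (Src, Src) \<or> e' = g (lev e')" by blast
  have "e' = (Src, Src) \<or> e' = (g(k := p)) (lev e')"
    if nz: "coef w e' (fst e) \<noteq> 0 \<or> coef w e' (snd e) \<noteq> 0" for e'
  proof (cases "e' = p")
    case True
    then show ?thesis using lev_diamond_edge[OF p] by simp
  next
    case False
    then have p_nz: "coef w e' (fst p) \<noteq> 0 \<or> coef w e' (snd p) \<noteq> 0"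
      using nz unfolding e by (cases p) (auto simp: child_edge_def Let_def split: if_splits)
    have "lev e' \<noteq> k" if "e' \<noteq> (Src, Src)"
    proof
      assume "lev e' = k"
      then have "vertex_depth (fst p) \<le> lev e'" "vertex_depth (snd p) \<le> lev e'"
        using lev_diamond_edge[OF p] by (auto simp: lev_def)
      then show False using p_nz coef_eq_0[of _ e' w] that by blast
    qed
    with g[OF p_nz] show ?thesis by auto
  qed
  then show ?case by blast
qed

text \<open>
  Once an edge has been replaced, its coordinate is halved along edges in each further step.
\<close>

lemma coef_edge_diff_le:
  assumes "0 < w" "e \<in> diamond_edges l" "lev e' < l" "e' = (Src, Src) \<or> e' \<in> diamond_edges (lev e')"
  shows "\<bar>coef w e' (fst e) - coef w e' (snd e)\<bar> \<le> 2 * w ^ lev e' / 2 ^ (l - lev e')"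
  using assms(2,3)
proof (induction l arbitrary: e)
  case (Suc l)
  then obtain p s h where p: "p \<in> diamond_edges l" and e: "e = child_edge p s h"
    unfolding diamond_edges_Suc by blast
  define a where "a = coef w e' (if h then snd p else fst p)"
  define b where "b = coef w e' (New (fst p) (snd p) s)"
  have diff: "\<bar>coef w e' (fst e) - coef w e' (snd e)\<bar> = \<bar>a - b\<bar>"
    by (cases "s = h") (simp_all add: e child_edge_def Let_def a_def b_def abs_minus_commute)
  show ?case
  proof (cases "lev e' < l")
    case True
    then have "e' \<noteq> p" using lev_diamond_edge[OF p] by auto
    then have "b = (coef w e' (fst p) + coef w e' (snd p)) / 2" by (simp add: b_def)
    then have "\<bar>a - b\<bar> = \<bar>coef w e' (fst p) - coef w e' (snd p)\<bar> / 2"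
      by (auto simp: a_def abs_if field_simps)
    also have "\<dots> \<le> 2 * w ^ lev e' / 2 ^ (l - lev e') / 2"
      by (intro divide_right_mono Suc.IH[OF p True]) simp
    also have "\<dots> = 2 * w ^ lev e' / 2 ^ (Suc l - lev e')"
      using True by (simp add: Suc_diff_le)
    finally show ?thesis using diff by simp
  next
    case False
    with Suc.prems(2) have l: "lev e' = l" by simp
    show ?thesis
    proof (cases "e' = (Src, Src)")
      case root: True
      then have "l = 0" using l by (simp add: lev_def)
      then have "p = (Src, Snk)" using p by simp
      then show ?thesis using root l \<open>l = 0\<close> diff by (cases h) (auto simp: a_def b_def lev_def)
    next
      case False
      have "vertex_depth (fst p) \<le> lev e'" "vertex_depth (snd p) \<le> lev e'"
        using lev_diamond_edge[OF p] l by (auto simp: lev_def)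
      then have "coef w e' (fst p) = 0" "coef w e' (snd p) = 0"
        using coef_eq_0[of _ e' w] False by blast+
      then have "a = 0" "\<bar>b\<bar> \<le> w ^ lev e'" using assms(1) by (auto simp: a_def b_def)
      then show ?thesis using diff l by simp
    qed
  qed
qed simp

text \<open>
  The indices of all coordinates that can be nonzero at a vertex of \<open>W\<^sub>n\<close>.
\<close>

definition index_set :: "nat \<Rightarrow> (vertex \<times> vertex) set" where
  "index_set n = insert (Src, Src) (\<Union>l<n. diamond_edges l)"

lemma finite_index_set: "finite (index_set n)"
  by (simp add: index_set_def finite_diamond_edges)

lemma index_set_level: "e \<in> index_set n \<Longrightarrow> e = (Src, Src) \<or> e \<in> diamond_edges (lev e)"
  by (auto simp: index_set_def lev_diamond_edge)

lemma sum_geometric_tail_le: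
  fixes \<kappa> :: real
  assumes "0 \<le> \<kappa>" "\<kappa> < 1"
  shows "(\<Sum>l\<in>{l. l < n \<and> L \<le> (if l < j then j - l else l - j)}. \<kappa> ^ (if l < j then j - l else l - j))
    \<le> 2 * \<kappa> ^ L / (1 - \<kappa>)"
proof -
  have tail: "(\<Sum>i\<in>A. \<kappa> ^ i) \<le> \<kappa> ^ L / (1 - \<kappa>)" if A: "finite A" "A \<subseteq> {L..}" for A
  proof -
    have "(\<Sum>i\<in>A. \<kappa> ^ i) \<le> (\<Sum>i\<in>{L..<L + Suc (Max (insert 0 A))}. \<kappa> ^ i)"
      using assms A by (intro sum_mono2) (auto simp: less_Suc_eq_le trans_le_add2)
    also have "\<dots> = (\<Sum>i<Suc (Max (insert 0 A)). \<kappa> ^ (i + L))"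
      using sum.shift_bounds_nat_ivl[of "\<lambda>i. \<kappa> ^ i" 0 L "Suc (Max (insert 0 A))"]
      by (simp only: atLeast0LessThan add.commute[of L] add_0)
    also have "\<dots> = \<kappa> ^ L * (\<Sum>i<Suc (Max (insert 0 A)). \<kappa> ^ i)"
      by (simp only: sum_distrib_left power_add mult.commute)
    also have "(\<Sum>i<Suc (Max (insert 0 A)). \<kappa> ^ i) \<le> 1 / (1 - \<kappa>)"
      using assms by (simp only: sum_gp_strict) (simp add: divide_right_mono)
    finally show ?thesis using assms by (simp add: mult_left_mono)
  qed
  let ?S = "{l. l < n \<and> L \<le> (if l < j then j - l else l - j)}"
  let ?c = "\<lambda>l. if l < j then j - l else l - j"
  have "(\<Sum>l\<in>?S. \<kappa> ^ ?c l) = (\<Sum>l\<in>?S \<inter> {..<j}. \<kappa> ^ ?c l) + (\<Sum>l\<in>?S - {..<j}. \<kappa> ^ ?c l)"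
    by (subst sum.Int_Diff[of ?S _ "{..<j}"]) auto
  also have "(\<Sum>l\<in>?S \<inter> {..<j}. \<kappa> ^ ?c l) = (\<Sum>i\<in>(\<lambda>l. j - l) ` (?S \<inter> {..<j}). \<kappa> ^ i)"
    by (subst sum.reindex) (auto simp: inj_on_def intro!: sum.cong)
  also have "\<dots> \<le> \<kappa> ^ L / (1 - \<kappa>)" by (rule tail) (auto split: if_splits)
  also have "(\<Sum>l\<in>?S - {..<j}. \<kappa> ^ ?c l) = (\<Sum>i\<in>(\<lambda>l. l - j) ` (?S - {..<j}). \<kappa> ^ i)"
    by (subst sum.reindex) (auto simp: inj_on_def intro!: sum.cong)
  also have "\<dots> \<le> \<kappa> ^ L / (1 - \<kappa>)" by (rule tail) (auto split: if_splits)
  finally show ?thesis by simp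
qed

context diamond_metric
begin

text \<open>
  The rate at which differences of coordinates decay away from the scale of a pair: \<open>w\<close> on finer
  levels, \<open>1 / (2 w)\<close> on coarser ones.
\<close>

definition decay :: real where "decay = max w (1 / (2 * w))"

lemma decay_bounds: "0 < decay" "decay < 1" "w \<le> decay" "1 / (2 * w) \<le> decay"
  using w by (auto simp: decay_def max_def)

text \<open>
  The exponent is the distance of the level of \<open>e\<close> from the scale \<open>j\<close> of the pair, \<open>w\<^sup>j \<approx> d x y\<close>. On
  finer levels the coordinates are bounded by the weights. On coarser levels, a nearly shortest walk
  from \<open>x\<close> to \<open>y\<close> uses only edges of level at least \<open>j\<close>, and there the coordinate of \<open>e\<close> is Lipschitz
  with a constant of order \<open>(1 / (2 w))\<^bsup>j - i\<^esup>\<close>, where \<open>i\<close> is the level of \<open>e\<close>.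
\<close>

lemma coef_diff_le_decay:
  assumes xy: "x \<in> V" "y \<in> V" and e: "e \<in> index_set n"
    and j: "w ^ j \<le> d x y" "0 < j \<Longrightarrow> d x y < w ^ (j - 1)"
  shows "\<bar>coef w e x - coef w e y\<bar> \<le> 2 * d x y * decay ^ (if lev e < j then j - lev e else lev e - j)"
proof (cases "lev e < j")
  case True
  let ?i = "lev e"
  have "dist (coef w e x) (coef w e y) \<le> (2 * (1 / (2 * w)) ^ (j - ?i)) * d x y"
  proof (rule lipschitz_on_short_edges[OF xy])
    show "d x y < w ^ (j - 1)" using j(2) True by simp
    show "0 \<le> 2 * (1 / (2 * w)) ^ (j - ?i)" using w by simp
    fix e' l assume e': "e' \<in> diamond_edges l" "w ^ l < w ^ (j - 1)"
    have jl: "j \<le> l"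
    proof (rule ccontr)
      assume "\<not> j \<le> l"
      then have "w ^ (j - 1) \<le> w ^ l" using w by (intro power_decreasing) auto
      with e'(2) show False by simp
    qed
    have "dist (coef w e (fst e')) (coef w e (snd e')) \<le> 2 * w ^ ?i / 2 ^ (l - ?i)"
      unfolding dist_real_def using e' jl True w index_set_level[OF e] by (intro coef_edge_diff_le) auto
    also have "\<dots> = 2 * (1 / (2 * w)) ^ (l - ?i) * w ^ l"
    proof -
      have "w ^ l = w ^ ?i * w ^ (l - ?i)" using jl True by (simp flip: power_add)
      then show ?thesis using w by (simp add: power_divide power_mult_distrib)
    qed
    also have "\<dots> \<le> 2 * (1 / (2 * w)) ^ (j - ?i) * w ^ l"
      using w jl by (intro mult_right_mono mult_left_mono power_decreasing) auto
    finally show "dist (coef w e (fst e')) (coef w e (snd e')) \<le> 2 * (1 / (2 * w)) ^ (j - ?i) * w ^ l" .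
  qed
  also have "\<dots> \<le> (2 * decay ^ (j - ?i)) * d x y"
    using w decay_bounds j(1) order_trans[OF zero_le_power[of w j] j(1)]
    by (intro mult_right_mono mult_left_mono power_mono) auto
  finally show ?thesis using True by (simp add: dist_real_def mult_ac)
next
  case False
  have "\<bar>coef w e x - coef w e y\<bar> \<le> 2 * w ^ lev e"
    using abs_coef_le[of w e x] abs_coef_le[of w e y] w by simp
  also have "w ^ lev e = w ^ j * w ^ (lev e - j)" using False by (simp flip: power_add)
  also have "\<dots> \<le> d x y * decay ^ (lev e - j)"
    using w decay_bounds j(1) order_trans[OF zero_le_power[of w j] j(1)]
    by (intro mult_mono power_mono) auto
  finally show ?thesis using False by simp
qed

lemma coef_nonzero_per_level:
  assumes "x \<in> V" "y \<in> V"
  shows "finite {e. lev e = l \<and> coef w e x \<noteq> coef w e y} \<and>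
    card {e. lev e = l \<and> coef w e x \<noteq> coef w e y} \<le> 3"
proof -
  have ex: "\<exists>g. \<forall>e. coef w e z \<noteq> 0 \<longrightarrow> e = (Src, Src) \<or> e = g (lev e)" if z: "z \<in> V" for z
  proof -
    obtain e where e: "e \<in> diamond_edges n" "z = fst e \<or> z = snd e"
      using z by (force simp: weighted_diamond_def diamond_def Field_def)
    from coef_chain[OF e(1), of w] obtain g where
      "\<forall>e'. coef w e' (fst e) \<noteq> 0 \<or> coef w e' (snd e) \<noteq> 0 \<longrightarrow> e' = (Src, Src) \<or> e' = g (lev e')" ..
    with e(2) show ?thesis by (intro exI[of _ g]) auto
  qed
  obtain g where g: "\<And>e. coef w e x \<noteq> 0 \<Longrightarrow> e = (Src, Src) \<or> e = g (lev e)"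
    using ex[OF assms(1)] by blast
  obtain h where h: "\<And>e. coef w e y \<noteq> 0 \<Longrightarrow> e = (Src, Src) \<or> e = h (lev e)"
    using ex[OF assms(2)] by blast
  have sub: "{e. lev e = l \<and> coef w e x \<noteq> coef w e y} \<subseteq> {(Src, Src), g l, h l}"
  proof
    fix e assume "e \<in> {e. lev e = l \<and> coef w e x \<noteq> coef w e y}"
    then have "lev e = l" "coef w e x \<noteq> 0 \<or> coef w e y \<noteq> 0" by auto
    with g[of e] h[of e] show "e \<in> {(Src, Src), g l, h l}" by auto
  qed
  have "card {(Src, Src), g l, h l} \<le> 3" by (simp add: card_insert_if)
  with card_mono[OF _ sub] finite_subset[OF sub] show ?thesis by simp
qed

text \<open>
  The set \<open>S\<close> consists of the indices within \<open>L\<close> levels of the scale of the pair. Each level has at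
  most three indices (one for each vertex, and the root), so the rest is a geometric series.
\<close>

lemma coef_diff_concentrated:
  assumes xy: "x \<in> V" "y \<in> V" "x \<noteq> y" and \<eta>: "0 < \<eta>" and L: "12 * decay ^ L / (1 - decay) \<le> \<eta>"
  obtains S where "S \<subseteq> index_set n" "card S \<le> 6 * L"
    "(\<Sum>e\<in>index_set n - S. \<bar>coef w e x - coef w e y\<bar>) \<le> \<eta> * d x y"
proof -
  have d: "0 < d x y" by (rule dist_pos[OF xy])
  define j where "j = (LEAST j. w ^ j \<le> d x y)"
  obtain j0 where "w ^ j0 < d x y" using real_arch_pow_inv[OF d w(2)] by blast
  then have "w ^ j0 \<le> d x y" by simp
  then have j: "w ^ j \<le> d x y" unfolding j_def by (rule LeastI[of "\<lambda>j. w ^ j \<le> d x y"])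
  have j': "d x y < w ^ (j - 1)" if "0 < j"
    using not_less_Least[of "j - 1" "\<lambda>j. w ^ j \<le> d x y"] that by (simp add: j_def not_le)
  let ?c = "\<lambda>l. if l < j then j - l else l - j"
  define N where "N l = {e. lev e = l \<and> coef w e x \<noteq> coef w e y}" for l
  have N: "finite (N l)" "card (N l) \<le> 3" for l
    using coef_nonzero_per_level[OF xy(1,2), of l] by (simp_all add: N_def)
  define I where "I = index_set n"
  define near where "near = {l. ?c l < L}"
  have near: "finite near" "card near \<le> 2 * L"
  proof -
    have "near \<subseteq> {j - L..<j + L}" by (auto simp: near_def split: if_splits)
    then show "finite near" "card near \<le> 2 * L"
      using finite_subset card_mono[of "{j - L..<j + L}" near] by auto
  qed
  define S where "S = I \<inter> (\<Union>l\<in>near. N l)"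
  have "card S \<le> card (\<Union>l\<in>near. N l)"
    unfolding S_def using near N by (intro card_mono) auto
  also have "\<dots> \<le> (\<Sum>l\<in>near. card (N l))" by (rule card_UN_le[OF near(1)])
  also have "\<dots> \<le> (\<Sum>l\<in>near. 3)" by (intro sum_mono N)
  also have "\<dots> \<le> 6 * L" using near(2) by simp
  finally have cardS: "card S \<le> 6 * L" .
  have finI: "finite I" by (simp add: I_def finite_index_set)
  define far where "far = {l. l < Suc n \<and> L \<le> ?c l}"
  have "(\<Sum>e\<in>I - S. \<bar>coef w e x - coef w e y\<bar>) = (\<Sum>e\<in>(I - S) \<inter> {e. coef w e x \<noteq> coef w e y}. \<bar>coef w e x - coef w e y\<bar>)"
    using finI by (intro sum.mono_neutral_right) auto
  also have "\<dots> \<le> (\<Sum>e\<in>(\<Union>l\<in>far. I \<inter> N l). \<bar>coef w e x - coef w e y\<bar>)"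
  proof (rule sum_mono2)
    show "finite (\<Union>l\<in>far. I \<inter> N l)" using finI by (auto simp: far_def)
    have "lev e < Suc n" if "e \<in> I" for e
      using that by (auto simp: I_def index_set_def lev_diamond_edge lev_def[of "(Src, Src)"])
    then show "(I - S) \<inter> {e. coef w e x \<noteq> coef w e y} \<subseteq> (\<Union>l\<in>far. I \<inter> N l)"
      by (auto simp: S_def N_def near_def far_def not_less split: if_splits)
  qed simp
  also have "\<dots> = (\<Sum>l\<in>far. \<Sum>e\<in>I \<inter> N l. \<bar>coef w e x - coef w e y\<bar>)"
    by (rule sum.UNION_disjoint) (use finI in \<open>auto simp: far_def N_def\<close>)
  also have "\<dots> \<le> (\<Sum>l\<in>far. 6 * d x y * decay ^ ?c l)"
  proof (rule sum_mono)
    fix l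
    have "(\<Sum>e\<in>I \<inter> N l. \<bar>coef w e x - coef w e y\<bar>) \<le> (\<Sum>e\<in>I \<inter> N l. 2 * d x y * decay ^ ?c l)"
    proof (rule sum_mono)
      fix e assume "e \<in> I \<inter> N l"
      then show "\<bar>coef w e x - coef w e y\<bar> \<le> 2 * d x y * decay ^ ?c l"
        using coef_diff_le_decay[OF xy(1,2) _ j j', of e] by (auto simp: I_def N_def)
    qed
    also have "\<dots> = card (I \<inter> N l) * (2 * d x y * decay ^ ?c l)" by simp
    also have "\<dots> \<le> 3 * (2 * d x y * decay ^ ?c l)"
    proof (rule mult_right_mono)
      have "card (I \<inter> N l) \<le> card (N l)" using N(1) by (intro card_mono) auto
      then show "real (card (I \<inter> N l)) \<le> 3" using N(2)[of l] by linarith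
      show "0 \<le> 2 * d x y * decay ^ ?c l"
        using d less_imp_le[OF decay_bounds(1)] by (intro mult_nonneg_nonneg zero_le_power) simp_all
    qed
    finally show "(\<Sum>e\<in>I \<inter> N l. \<bar>coef w e x - coef w e y\<bar>) \<le> 6 * d x y * decay ^ ?c l" by simp
  qed
  also have "\<dots> = 6 * d x y * (\<Sum>l\<in>far. decay ^ ?c l)" by (simp only: sum_distrib_left)
  also have "\<dots> \<le> 6 * d x y * (2 * decay ^ L / (1 - decay))"
    unfolding far_def using d decay_bounds by (intro mult_left_mono sum_geometric_tail_le) auto
  also have "\<dots> = (12 * decay ^ L / (1 - decay)) * d x y" by simp
  also have "\<dots> \<le> \<eta> * d x y" using L d by (intro mult_right_mono) auto
  finally show thesis using that[of S] cardS by (simp add: S_def I_def)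
qed

end

section \<open>Embedding into spaces of linear dimension\<close>

lemma dim_at_least_finite:
  assumes "dim_at_least X r"
  obtains B where "B \<subseteq> X" "finite B" "independent B" "r \<le> real (card B)"
proof -
  obtain A where A: "A \<subseteq> X" "independent A" "infinite A \<or> r \<le> real (card A)"
    using assms by (auto simp: dim_at_least_def)
  show thesis
  proof (cases "finite A")
    case False
    obtain k where "r \<le> real k" using real_arch_simple by blast
    moreover obtain B where "B \<subseteq> A" "finite B" "card B = k"
      using infinite_arbitrarily_large[OF False] by blast
    ultimately show thesis using that[of B] A independent_mono by blast
  qed (use A that in auto)
qed

lemma card_diamond_edges_le: "card (diamond_edges n) \<le> 4 ^ n"
proof (induction n)
  case (Suc n)
  have "diamond_edges (Suc n) = (\<lambda>(e, s, h). child_edge e s h) ` (diamond_edges n \<times> UNIV \<times> UNIV)"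
    unfolding diamond_edges_Suc by (fastforce simp: image_iff)
  also have "card \<dots> \<le> card (diamond_edges n \<times> (UNIV :: bool set) \<times> (UNIV :: bool set))"
    by (rule card_image_le) (simp add: finite_diamond_edges)
  also have "\<dots> = 4 * card (diamond_edges n)" by (simp add: card_cartesian_product)
  finally show ?case using Suc.IH by simp
qed simp

lemma card_index_set_le: "card (index_set n) \<le> 4 ^ n"
proof -
  have "card (index_set n) \<le> Suc (card (\<Union>l<n. diamond_edges l))"
    unfolding index_set_def by (rule card_insert_le_m1[of "Suc _", simplified]) simp
  also have "card (\<Union>l<n. diamond_edges l) \<le> (\<Sum>l<n. 4 ^ l)"
    by (rule order_trans[OF card_UN_le sum_mono]) (simp_all add: card_diamond_edges_le)
  also have "Suc (\<Sum>l<n. 4 ^ l) \<le> 4 ^ n" by (induction n) auto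
  finally show ?thesis by simp
qed

lemma card_diamond_edges_ge: "2 ^ n \<le> card (diamond_edges n)"
proof (induction n)
  case (Suc n)
  have inj: "inj_on (\<lambda>(e, s). child_edge e s s) (diamond_edges n \<times> UNIV)"
    by (auto simp: inj_on_def child_edge_def Let_def prod_eq_iff)
  have "2 ^ Suc n \<le> card (diamond_edges n \<times> (UNIV :: bool set))"
    using Suc.IH by (simp add: card_cartesian_product)
  also have "\<dots> = card ((\<lambda>(e, s). child_edge e s s) ` (diamond_edges n \<times> UNIV))"
    by (rule card_image[OF inj, symmetric])
  also have "\<dots> \<le> card (diamond_edges (Suc n))"
    by (rule card_mono[OF finite_diamond_edges], rule image_subsetI)
        (use child_edge_in in \<open>simp only: mem_Times_iff case_prod_unfold\<close>)
  finally show ?case .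
qed simp

lemma card_weighted_diamond_ge: "2 ^ n \<le> card (pverts (weighted_diamond n))"
proof (cases n)
  case 0
  then show ?thesis by (simp add: weighted_diamond_def diamond_verts_0)
next
  case (Suc k)
  let ?new = "\<lambda>(e, s). New (fst e) (snd e) s"
  have inj: "inj_on ?new (diamond_edges k \<times> UNIV)" by (auto simp: inj_on_def prod_eq_iff)
  have "2 ^ n \<le> card (diamond_edges k \<times> (UNIV :: bool set))"
    using card_diamond_edges_ge[of k] Suc by (simp add: card_cartesian_product)
  also have "\<dots> = card (?new ` (diamond_edges k \<times> UNIV))" by (rule card_image[OF inj, symmetric])
  also have "\<dots> \<le> card (pverts (weighted_diamond n))"
  proof (rule card_mono[OF finite_verts])
    show "?new ` (diamond_edges k \<times> UNIV) \<subseteq> pverts (weighted_diamond n)"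
      unfolding weighted_diamond_def Suc by (auto simp: diamond_verts_Suc)
  qed
  finally show ?thesis .
qed

lemma embeds_with_distortionI:
  fixes f :: "'v \<Rightarrow> 'a::metric_space"
  assumes range: "f ` V \<subseteq> X"
    and pos: "\<And>x y. x \<in> V \<Longrightarrow> y \<in> V \<Longrightarrow> x \<noteq> y \<Longrightarrow> 0 < d x y"
    and upper: "\<And>x y. x \<in> V \<Longrightarrow> y \<in> V \<Longrightarrow> dist (f x) (f y) \<le> d x y"
    and lower: "\<And>x y. x \<in> V \<Longrightarrow> y \<in> V \<Longrightarrow> x \<noteq> y \<Longrightarrow> d x y \<le> K * dist (f x) (f y)"
  shows "embeds_with_distortion V d X K"
proof -
  have dist_pos: "0 < dist (f x) (f y)" if "x \<in> V" "y \<in> V" "x \<noteq> y" for x y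
    using pos[OF that] lower[OF that] by (auto simp: zero_less_dist_iff)
  then have "inj_on f V" by (fastforce simp: inj_on_def)
  moreover have "distortion V d f \<le> 1 * ennreal K"
    unfolding distortion_def
  proof (rule mult_mono)
    show "(SUP (x, y)\<in>{(x, y). x \<in> V \<and> y \<in> V \<and> x \<noteq> y}. ennreal (dist (f x) (f y) / d x y)) \<le> 1"
      using upper pos by (auto intro!: SUP_least simp: ennreal_le_1)
    show "(SUP (x, y)\<in>{(x, y). x \<in> V \<and> y \<in> V \<and> x \<noteq> y}. ennreal (d x y / dist (f x) (f y))) \<le> ennreal K"
      using lower dist_pos by (auto intro!: SUP_least ennreal_leI simp: pos_divide_le_eq)
  qed auto
  ultimately show ?thesis using range by (auto simp: embeds_with_distortion_def)
qed

context diamond_metric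
begin

text \<open>
  The embedding described at the beginning. If \<open>R\<close> is the largest difference of a coordinate, the
  concentrated part of \<open>f x - f y\<close> has norm at least \<open>\<epsilon> R / 4\<close>, and the rest at most \<open>\<epsilon> R / 8\<close>. The
  set on which the sum is concentrated is enlarged by an index where \<open>R\<close> is attained, whence
  \<open>6 L + 1\<close>.
\<close>

lemma embeds_of_almost_independent:
  fixes X :: "vertex \<times> vertex \<Rightarrow> 'a::real_normed_vector"
  assumes L: "12 * decay ^ L / (1 - decay) \<le> (1 - w) / 64"
    and Y: "subspace Y" and X: "\<And>e. e \<in> index_set n \<Longrightarrow> X e \<in> Y \<and> norm (X e) \<le> 1"
    and indep: "\<And>S a e R. S \<subseteq> index_set n \<Longrightarrow> card S \<le> 6 * L + 1 \<Longrightarrow> e \<in> S \<Longrightarrow> \<bar>a e\<bar> = R \<Longrightarrow>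
      (\<And>i. i \<in> S \<Longrightarrow> \<bar>a i\<bar> \<le> R) \<Longrightarrow> R / 4 \<le> norm (\<Sum>i\<in>S. a i *\<^sub>R X i)"
  shows "embeds_with_distortion V d Y (64 / ((w - 1 / 2) * (1 - w)))"
proof -
  define I where "I = index_set n"
  have finI: "finite I" by (simp add: I_def finite_index_set)
  define \<epsilon> where "\<epsilon> = w - 1 / 2"
  have \<epsilon>: "0 < \<epsilon>" "\<epsilon> \<le> 1" "w = 1 / 2 + \<epsilon>" using w by (auto simp: \<epsilon>_def)
  define f where "f x = \<epsilon> *\<^sub>R (\<Sum>e\<in>I. coef w e x *\<^sub>R X e)" for x
  have f_new: "f (New (fst p) (snd p) s) = (1 / 2) *\<^sub>R (f (fst p) + f (snd p)) +
      ((if s then - 1 else 1) * \<epsilon> * w ^ l) *\<^sub>R X p"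
    if p: "p \<in> diamond_edges l" "l < n" for p l s
  proof -
    have pI: "p \<in> I" using p by (auto simp: I_def index_set_def)
    have "(\<Sum>e\<in>I. coef w e (New (fst p) (snd p) s) *\<^sub>R X e) =
        (\<Sum>e\<in>I. ((coef w e (fst p) + coef w e (snd p)) / 2) *\<^sub>R X e +
          (if e = p then ((if s then - 1 else 1) * w ^ l) *\<^sub>R X p else 0))"
      using lev_diamond_edge[OF p(1)] by (intro sum.cong refl) (auto simp: scaleR_add_left)
    also have "\<dots> = (\<Sum>e\<in>I. ((coef w e (fst p) + coef w e (snd p)) / 2) *\<^sub>R X e) +
        ((if s then - 1 else 1) * w ^ l) *\<^sub>R X p"
      using finI pI by (simp add: sum.distrib)
    also have "(\<Sum>e\<in>I. ((coef w e (fst p) + coef w e (snd p)) / 2) *\<^sub>R X e) =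
        (1 / 2) *\<^sub>R ((\<Sum>e\<in>I. coef w e (fst p) *\<^sub>R X e) + (\<Sum>e\<in>I. coef w e (snd p) *\<^sub>R X e))"
      unfolding scaleR_sum_right scaleR_add_right sum.distrib[symmetric]
      by (intro sum.cong refl) (simp add: add_divide_distrib scaleR_add_left)
    finally show ?thesis by (simp add: f_def scaleR_add_right mult_ac)
  qed
  have edge: "norm (f (fst e) - f (snd e)) \<le> w ^ l" if "e \<in> diamond_edges l" "l \<le> n" for e l
    using that
  proof (induction l arbitrary: e)
    case 0
    have root: "(Src, Src) \<in> I" by (simp add: I_def index_set_def)
    have "(\<Sum>e\<in>I. coef w e Snk *\<^sub>R X e) = (\<Sum>e\<in>I. if e = (Src, Src) then X e else 0)"
      by (intro sum.cong) auto
    then have "f Snk = \<epsilon> *\<^sub>R X (Src, Src)" using finI root by (simp add: f_def)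
    moreover have "norm (X (Src, Src)) \<le> 1" using X root by (simp add: I_def)
    moreover have "f Src = 0" by (simp add: f_def)
    ultimately show ?case using 0 \<epsilon> mult_mono[of \<epsilon> 1 "norm (X (Src, Src))" 1] by simp
  next
    case (Suc l)
    then obtain p s h where p: "p \<in> diamond_edges l" and e: "e = child_edge p s h"
      unfolding diamond_edges_Suc by blast
    have l: "l < n" using Suc.prems by simp
    have "p \<in> index_set n" using p l by (auto simp: index_set_def)
    then have pX: "norm (X p) \<le> 1" using X by blast
    let ?\<sigma> = "(if s then - 1 else 1) * \<epsilon> * w ^ l" and ?\<tau> = "if h then - 1 else 1 :: real"
    have "norm (f (fst e) - f (snd e)) = norm (f (if h then snd p else fst p) - f (New (fst p) (snd p) s))"
      by (cases "s = h") (simp_all add: e child_edge_def Let_def norm_minus_commute)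
    also have "f (if h then snd p else fst p) - f (New (fst p) (snd p) s) =
        (?\<tau> / 2) *\<^sub>R (f (fst p) - f (snd p)) - ?\<sigma> *\<^sub>R X p"
    proof -
      have half: "v = (1 / 2) *\<^sub>R v + (1 / 2) *\<^sub>R v" for v :: 'a
        by (simp flip: scaleR_add_left)
      show ?thesis unfolding f_new[OF p l]
        using half[of "f (fst p)"] half[of "f (snd p)"]
        by (cases h) (simp_all add: algebra_simps)
    qed
    also have "norm \<dots> \<le> norm ((?\<tau> / 2) *\<^sub>R (f (fst p) - f (snd p))) + norm (?\<sigma> *\<^sub>R X p)"
      by (rule norm_triangle_ineq4)
    also have "\<dots> = norm (f (fst p) - f (snd p)) / 2 + \<epsilon> * w ^ l * norm (X p)"
      using \<epsilon> w_bounds by (simp add: abs_mult)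
    also have "\<dots> \<le> w ^ l / 2 + \<epsilon> * w ^ l * 1"
      using Suc.IH[OF p] l pX \<epsilon> w_bounds by (intro add_mono mult_left_mono divide_right_mono) auto
    also have "\<dots> = w ^ Suc l" using \<epsilon>(3) by (simp add: algebra_simps)
    finally show ?case .
  qed
  show ?thesis
  proof (rule embeds_with_distortionI)
    show "f ` V \<subseteq> Y"
      unfolding f_def using X by (auto simp: I_def intro!: subspace_scale[OF Y] subspace_sum[OF Y])
    show "0 < d x y" if "x \<in> V" "y \<in> V" "x \<noteq> y" for x y by (rule dist_pos[OF that])
    show "dist (f x) (f y) \<le> d x y" if "x \<in> V" "y \<in> V" for x y
      using lipschitz_on_short_edges[OF that, of "d x y + 1" 1 f] edge by (simp add: dist_norm)
    fix x y assume xy: "x \<in> V" "y \<in> V" "x \<noteq> y"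
    define a where "a e = coef w e x - coef w e y" for e
    have I_ne: "I \<noteq> {}" by (simp add: I_def index_set_def)
    define R where "R = Max ((\<lambda>e. \<bar>a e\<bar>) ` I)"
    have R: "\<bar>a e\<bar> \<le> R" if "e \<in> I" for e unfolding R_def using finI that by (intro Max_ge) auto
    have "R \<in> (\<lambda>e. \<bar>a e\<bar>) ` I" unfolding R_def using finI I_ne by (intro Max_in) auto
    then obtain e0 where e0: "e0 \<in> I" "\<bar>a e0\<bar> = R" by auto
    have dR: "d x y \<le> 8 * R / (1 - w)"
      by (rule dist_le_coef_diff[OF xy(1,2)])
        (use R in \<open>auto simp: a_def I_def index_set_def\<close>)
    obtain S where S: "S \<subseteq> I" "card S \<le> 6 * L" "(\<Sum>e\<in>I - S. \<bar>a e\<bar>) \<le> (1 - w) / 64 * d x y"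
      using coef_diff_concentrated[OF xy _ L] w_bounds by (auto simp: I_def a_def)
    define S' where "S' = insert e0 S"
    have finS: "finite S" using S(1) finI finite_subset by blast
    have S': "S' \<subseteq> I" "card S' \<le> 6 * L + 1"
      using S(1,2) e0(1) finS by (auto simp: S'_def card_insert_if)
    have "(\<Sum>e\<in>I - S'. \<bar>a e\<bar>) \<le> (\<Sum>e\<in>I - S. \<bar>a e\<bar>)"
      using finI by (intro sum_mono2) (auto simp: S'_def)
    also note S(3)
    also have "(1 - w) / 64 * d x y \<le> (1 - w) / 64 * (8 * R / (1 - w))"
      using dR w_bounds by (intro mult_left_mono) auto
    also have "\<dots> = R / 8" using w_bounds by (simp add: field_simps)
    finally have rest: "(\<Sum>e\<in>I - S'. \<bar>a e\<bar>) \<le> R / 8" .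
    have "R / 4 \<le> norm (\<Sum>e\<in>S'. a e *\<^sub>R X e)"
      by (rule indep[of S' e0]) (use S' e0 R in \<open>auto simp: S'_def I_def\<close>)
    also have "(\<Sum>e\<in>S'. a e *\<^sub>R X e) = (\<Sum>e\<in>I. a e *\<^sub>R X e) - (\<Sum>e\<in>I - S'. a e *\<^sub>R X e)"
      using sum.subset_diff[OF S'(1) finI, of "\<lambda>e. a e *\<^sub>R X e"] by simp
    also have "norm \<dots> \<le> norm (\<Sum>e\<in>I. a e *\<^sub>R X e) + norm (\<Sum>e\<in>I - S'. a e *\<^sub>R X e)"
      by (rule norm_triangle_ineq4)
    also have "norm (\<Sum>e\<in>I - S'. a e *\<^sub>R X e) \<le> (\<Sum>e\<in>I - S'. \<bar>a e\<bar>)"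
    proof (rule sum_norm_le)
      fix e assume "e \<in> I - S'"
      then have "norm (X e) \<le> 1" using X by (auto simp: I_def)
      then show "norm (a e *\<^sub>R X e) \<le> \<bar>a e\<bar>" using mult_left_mono[of "norm (X e)" 1 "\<bar>a e\<bar>"] by simp
    qed
    also note rest
    finally have "R / 8 \<le> norm (\<Sum>e\<in>I. a e *\<^sub>R X e)" by simp
    also have "\<dots> = dist (f x) (f y) / \<epsilon>"
    proof -
      have "f x - f y = \<epsilon> *\<^sub>R (\<Sum>e\<in>I. a e *\<^sub>R X e)"
        by (simp add: f_def a_def scaleR_left_diff_distrib sum_subtractf scaleR_right_diff_distrib)
      then show ?thesis using \<epsilon> by (simp add: dist_norm)
    qed
    finally have "8 * R / (1 - w) \<le> 64 * (dist (f x) (f y) / \<epsilon>) / (1 - w)"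
      using w_bounds by (intro divide_right_mono) auto
    with dR show "d x y \<le> 64 / ((w - 1 / 2) * (1 - w)) * dist (f x) (f y)"
      by (simp add: \<epsilon>_def mult_ac)
  qed
qed

end

text \<open>
  With \<open>M \<le> 4\<^sup>n\<close> indices, the union bound needs \<open>M (9 m M)\<^sup>m (3/4)\<^sup>N < 1\<close>, and the factor in front of
  \<open>(3/4)\<^sup>N\<close> is at most \<open>b\<^sup>n\<close> for a constant \<open>b\<close>.
\<close>

lemma linear_dimension_suffices:
  assumes w: "1 / 2 < w" "w < 1"
  obtains A :: nat where "0 < A"
    "\<And>n Y. 0 < n \<Longrightarrow> subspace (Y :: 'a::real_normed_vector set) \<Longrightarrow> dim_at_least Y (A * n) \<Longrightarrow>
      embeds_with_distortion (pverts (weighted_diamond n)) (weighted_diamond_dist (w - 1 / 2) n) Y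
        (64 / ((w - 1 / 2) * (1 - w)))"
proof -
  interpret m0: diamond_metric w 0 using w by unfold_locales
  have "0 < (1 - m0.decay) * (1 - w) / 768"
    using w m0.decay_bounds by simp
  then obtain L where "m0.decay ^ L < (1 - m0.decay) * (1 - w) / 768"
    using real_arch_pow_inv m0.decay_bounds(2) by blast
  then have L: "12 * m0.decay ^ L / (1 - m0.decay) \<le> (1 - w) / 64"
    using m0.decay_bounds by (simp add: field_simps)
  define m where "m = 6 * L + 1"
  have m: "0 < m" by (simp add: m_def)
  define b where "b = 4 ^ (m + 1) * (9 * m) ^ m"
  obtain A0 where A0: "real b < (4 / 3) ^ A0" using real_arch_pow[of "4 / 3" "real b"] by auto
  define A where "A = Suc A0"
  have A: "real b < (4 / 3) ^ A" using A0 by (simp add: A_def)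
  have "embeds_with_distortion (pverts (weighted_diamond n)) (weighted_diamond_dist (w - 1 / 2) n) Y
      (64 / ((w - 1 / 2) * (1 - w)))"
    if n: "0 < n" and Y: "subspace Y" "dim_at_least Y (A * n)" for n and Y :: "'a set"
  proof -
    interpret diamond_metric w n using w by unfold_locales
    obtain B where B: "B \<subseteq> Y" "finite B" "independent B" "real (A * n) \<le> real (card B)"
      using dim_at_least_finite[OF Y(2)] by blast
    define M where "M = card (index_set n)"
    have "M * (M * (9 * m)) ^ m \<le> 4 ^ n * (4 ^ n * (9 * m) ^ n) ^ m"
      using card_index_set_le[of n] n unfolding M_def m_def
      by (intro mult_mono power_mono self_le_power) auto
    also have "\<dots> = b ^ n"
      by (simp add: b_def power_mult_distrib mult_ac flip: power_mult power_add)
    finally have "real (M * (M * (9 * m)) ^ m) \<le> real b ^ n"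
      by (metis of_nat_le_iff of_nat_power)
    also have "\<dots> < ((4 / 3) ^ A) ^ n" using A n by (intro power_strict_mono) auto
    also have "\<dots> \<le> (4 / 3) ^ card B"
      using B(4) by (simp only: power_mult[symmetric] of_nat_le_iff) (simp add: power_increasing)
    finally have "real (M * (M * (9 * m)) ^ m) * (3 / 4) ^ card B < (4 / 3) ^ card B * (3 / 4) ^ card B"
      by (intro mult_strict_right_mono) auto
    also have "\<dots> = 1" by (simp flip: power_mult_distrib)
    finally have small: "real (card (index_set n) * (card (index_set n) * (9 * m)) ^ m) * (3 / 4) ^ card B < 1"
      by (simp add: M_def)
    obtain X where X: "\<And>e. e \<in> index_set n \<Longrightarrow> X e \<in> span B \<and> norm (X e) \<le> 1"
      and indep: "\<And>S a e R. S \<subseteq> index_set n \<Longrightarrow> card S \<le> m \<Longrightarrow> e \<in> S \<Longrightarrow> \<bar>a e\<bar> = R \<Longrightarrow>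
        (\<And>i. i \<in> S \<Longrightarrow> \<bar>a i\<bar> \<le> R) \<Longrightarrow> R / 4 \<le> norm (\<Sum>i\<in>S. a i *\<^sub>R X i)"
      using almost_independent_vectors[OF B(2,3) finite_index_set m small] by blast
    have "span B \<subseteq> Y" by (rule span_minimal[OF B(1) Y(1)])
    with X show ?thesis
      by (intro embeds_of_almost_independent[of L Y X] indep L Y(1)) (auto simp: m_def)
  qed
  then show thesis using that[of A] by (simp add: A_def)
qed

text \<open>
  With \<open>t = ln (n ln 2)\<close> the claim becomes \<open>ln (A / ln 2) + t \<le> 2 t\<^sup>2\<close>, which holds for \<open>t \<ge> 1\<close> and
  \<open>t \<ge> ln (A / ln 2)\<close>.
\<close>

lemma linear_le_exp_ln_ln_square:
  fixes A :: nat
  assumes A: "0 < A" and N: "2 ^ n \<le> N"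
    and n: "exp (max 1 (ln (A / ln 2))) / ln 2 \<le> real n"
  shows "real (A * n) \<le> exp (2 * (ln (ln (real N))) ^ 2)"
proof -
  define t where "t = ln (real n * ln 2)"
  have exp_le: "exp (max 1 (ln (A / ln 2))) \<le> real n * ln 2" using n by (simp add: pos_divide_le_eq)
  then have pos: "0 < real n * ln 2" by (meson exp_gt_zero less_le_trans)
  have "max 1 (ln (A / ln 2)) \<le> t" using exp_le by (simp only: t_def ln_ge_iff[OF pos])
  then have t: "1 \<le> t" "ln (A / ln 2) \<le> t" by simp_all
  have "(2 :: real) ^ n \<le> real N" using N by (metis of_nat_le_iff of_nat_numeral of_nat_power)
  then have "ln (2 ^ n) \<le> ln (real N)" by (intro ln_mono) simp_all
  then have "real n * ln 2 \<le> ln (real N)" by (simp add: ln_realpow)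
  then have "t \<le> ln (ln (real N))" unfolding t_def using pos by (subst ln_le_cancel_iff) auto
  then have "t ^ 2 \<le> (ln (ln (real N))) ^ 2" using t by (intro power_mono) auto
  moreover have "t \<le> t ^ 2" using t(1) by (simp add: self_le_power)
  ultimately have "ln (A / ln 2) + t \<le> 2 * (ln (ln (real N))) ^ 2" using t(2) by linarith
  then have "exp (ln (A / ln 2) + t) \<le> exp (2 * (ln (ln (real N))) ^ 2)" by simp
  also have "exp (ln (A / ln 2) + t) = A / ln 2 * (real n * ln 2)"
    using A pos by (simp add: exp_add t_def)
  also have "\<dots> = real (A * n)" by simp
  finally show ?thesis .
qed

section \<open>Isometric embedding of finite-dimensional spaces into a space of bounded sequences\<close>

text \<open>
  The step of the Hahn-Banach theorem: the value at \<open>b\<close> is chosen between the lower bounds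
  \<open>\<phi> x - norm (x - b)\<close> and the upper bounds \<open>norm (y + b) - \<phi> y\<close>. The functional is kept linear on
  the whole type, but it is dominated by the norm only on the span.
\<close>

lemma extend_dominated_functional:
  fixes \<phi> :: "'a::real_normed_vector \<Rightarrow> real"
  assumes lin: "linear \<phi>" and dom: "\<And>x. x \<in> span S \<Longrightarrow> \<phi> x \<le> norm x"
  obtains \<psi> where "linear \<psi>" "\<And>x. x \<in> span S \<Longrightarrow> \<psi> x = \<phi> x"
    "\<And>x. x \<in> span (insert b S) \<Longrightarrow> \<psi> x \<le> norm x"
proof (cases "b \<in> span S")
  case True
  then show thesis using that[OF lin] dom by (simp add: span_redundant)
next
  case False
  define W where "W = (\<lambda>x. \<phi> x - norm (x - b)) ` span S"
  have ineq: "\<phi> x - norm (x - b) \<le> norm (y + b) - \<phi> y" if "x \<in> span S" "y \<in> span S" for x y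
  proof -
    have "\<phi> x + \<phi> y = \<phi> (x + y)" by (simp add: linear_add[OF lin])
    also have "\<dots> \<le> norm (x + y)" using that by (intro dom span_add)
    also have "\<dots> \<le> norm (x - b) + norm (y + b)"
      using norm_triangle_ineq[of "x - b" "y + b"] by simp
    finally show ?thesis by simp
  qed
  define \<alpha> where "\<alpha> = Sup W"
  have upper: "\<alpha> \<le> norm (y + b) - \<phi> y" if "y \<in> span S" for y
    unfolding \<alpha>_def W_def
    by (rule cSup_least) (use ineq that span_zero in auto)
  have lower: "\<phi> x - norm (x - b) \<le> \<alpha>" if "x \<in> span S" for x
    unfolding \<alpha>_def W_def
    by (rule cSup_upper) (use ineq that span_zero in \<open>auto intro!: bdd_aboveI2[of _ _ "norm (0 + b) - \<phi> 0"]\<close>)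
  obtain A where A: "A \<subseteq> S" "independent A" "S \<subseteq> span A"
    using maximal_independent_subset by blast
  have spanA: "span A = span S"
    using A by (metis span_mono span_span subset_antisym)
  have "independent (insert b A)" using A False by (simp add: independent_insert spanA)
  from linear_independent_extend[OF this, of "\<lambda>x. if x = b then 1 else 0"] obtain \<eta> :: "'a \<Rightarrow> real"
    where \<eta>: "linear \<eta>" "\<forall>x\<in>insert b A. \<eta> x = (if x = b then 1 else 0)" by blast
  have "b \<notin> A" using False span_base spanA by blast
  then have "\<eta> x = 0" if "x \<in> A" for x using that \<eta>(2) by auto
  then have \<eta>0: "\<eta> x = 0" if "x \<in> span S" for x
    using linear_eq_0_on_span[OF \<eta>(1)] that spanA by blast
  define \<psi> where "\<psi> x = \<phi> x + (\<alpha> - \<phi> b) * \<eta> x" for x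
  show thesis
  proof (rule that[of \<psi>])
    show "linear \<psi>"
      by (rule linearI)
        (simp_all add: \<psi>_def linear_add[OF lin] linear_add[OF \<eta>(1)] linear_cmul[OF lin]
          linear_cmul[OF \<eta>(1)] algebra_simps)
    show "\<psi> x = \<phi> x" if "x \<in> span S" for x using \<eta>0[OF that] by (simp add: \<psi>_def)
    fix x assume "x \<in> span (insert b S)"
    then obtain k where k: "x - k *\<^sub>R b \<in> span S" using span_breakdown_eq by blast
    define y where "y = x - k *\<^sub>R b"
    have x: "x = y + k *\<^sub>R b" by (simp add: y_def)
    have y: "y \<in> span S" using k by (simp add: y_def)
    have \<psi>x: "\<psi> x = \<phi> y + k * \<alpha>"
      using \<eta>0[OF y] \<eta>(2)
      by (simp add: \<psi>_def x linear_add[OF lin] linear_add[OF \<eta>(1)] linear_cmul[OF lin]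
          linear_cmul[OF \<eta>(1)] algebra_simps)
    have yl: "(1 / l) *\<^sub>R y \<in> span S" for l using y by (rule span_scale)
    have \<phi>l: "\<phi> ((1 / l) *\<^sub>R y) = \<phi> y / l" for l by (simp add: linear_cmul[OF lin])
    consider "k = 0" | "0 < k" | "k < 0" by linarith
    then show "\<psi> x \<le> norm x"
    proof cases
      case 1
      then show ?thesis using dom[OF y] \<psi>x by (simp add: x)
    next
      case 2
      have "k * \<alpha> \<le> k * (norm ((1 / k) *\<^sub>R y + b) - \<phi> y / k)"
        using upper[OF yl[of k]] 2 by (intro mult_left_mono) (simp_all add: \<phi>l)
      also have "\<dots> = norm (k *\<^sub>R ((1 / k) *\<^sub>R y + b)) - \<phi> y"
        using 2 by (simp add: right_diff_distrib)
      also have "k *\<^sub>R ((1 / k) *\<^sub>R y + b) = x" using 2 by (simp add: x scaleR_add_right)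
      finally show ?thesis using \<psi>x by simp
    next
      case 3
      define l where "l = - k"
      have l: "0 < l" "k = - l" using 3 by (simp_all add: l_def)
      have "l * (\<phi> y / l - norm ((1 / l) *\<^sub>R y - b)) \<le> l * \<alpha>"
        using lower[OF yl[of l]] l by (intro mult_left_mono) (simp_all add: \<phi>l)
      moreover have "l * (\<phi> y / l - norm ((1 / l) *\<^sub>R y - b)) = \<phi> y - norm (l *\<^sub>R ((1 / l) *\<^sub>R y - b))"
        using l by (simp add: right_diff_distrib)
      moreover have "l *\<^sub>R ((1 / l) *\<^sub>R y - b) = x" using l by (simp add: x scaleR_diff_right)
      ultimately show ?thesis using \<psi>x l(2) by simp
    qed
  qed
qed

lemma norming_functional_exists:
  fixes y :: "'a::real_normed_vector"
  assumes "finite B"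
  shows "\<exists>\<phi>. linear \<phi> \<and> \<phi> y = norm y \<and> (\<forall>x\<in>span (insert y B). \<phi> x \<le> norm x)"
  using assms
proof (induction B rule: finite_induct)
  case empty
  obtain \<phi> :: "'a \<Rightarrow> real" where \<phi>: "linear \<phi>" "\<phi> y = norm y"
  proof (cases "y = 0")
    case True
    then show thesis using that[of "\<lambda>_. 0"] by (simp add: linear_iff)
  next
    case False
    then have "independent {y}" by simp
    from linear_independent_extend[OF this, of "\<lambda>_. norm y"] show thesis using that by auto
  qed
  moreover have "\<phi> x \<le> norm x" if "x \<in> span {y}" for x
  proof -
    obtain k where "x = k *\<^sub>R y" using \<open>x \<in> span {y}\<close> by (auto simp: span_singleton)
    then show ?thesis using \<phi> by (simp add: linear_cmul mult_right_mono)
  qed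
  ultimately show ?case by blast
next
  case (insert b B)
  then obtain \<phi> where \<phi>: "linear \<phi>" "\<phi> y = norm y" "\<And>x. x \<in> span (insert y B) \<Longrightarrow> \<phi> x \<le> norm x"
    by blast
  obtain \<psi> where \<psi>: "linear \<psi>" "\<And>x. x \<in> span (insert y B) \<Longrightarrow> \<psi> x = \<phi> x"
    "\<And>x. x \<in> span (insert b (insert y B)) \<Longrightarrow> \<psi> x \<le> norm x"
    using extend_dominated_functional[OF \<phi>(1,3)] by blast
  have "\<psi> y = norm y" using \<psi>(2)[of y] \<phi>(2) by (simp add: span_base)
  with \<psi> show ?case by (intro exI[of _ \<psi>]) (simp add: insert_commute)
qed

lemma countable_dense_in_span:
  fixes B :: "'a::real_normed_vector set"
  assumes "finite B"
  obtains s :: "nat \<Rightarrow> 'a" where "\<And>k. s k \<in> span B"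
    "\<And>x e. x \<in> span B \<Longrightarrow> 0 < e \<Longrightarrow> \<exists>k. norm (x - s k) < e"
proof -
  define D where "D = (\<lambda>q. \<Sum>b\<in>B. real_of_rat (q b) *\<^sub>R b) ` (B \<rightarrow>\<^sub>E (UNIV :: rat set))"
  have D: "countable D" "D \<noteq> {}"
    using assms by (auto simp: D_def PiE_eq_empty_iff intro!: countable_image countable_PiE)
  have "D \<subseteq> span B" unfolding D_def by (intro image_subsetI span_sum span_scale span_base)
  moreover have "\<exists>k. norm (x - from_nat_into D k) < e" if x: "x \<in> span B" and e: "0 < e" for x e
  proof -
    obtain a where a: "x = (\<Sum>b\<in>B. a b *\<^sub>R b)" using span_finite_coeffs[OF assms x] by blast
    define S where "S = 1 + (\<Sum>b\<in>B. norm b)"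
    have S: "0 < S" "(\<Sum>b\<in>B. norm b) < S"
      unfolding S_def by (auto intro!: add_pos_nonneg sum_nonneg)
    have "\<exists>r. \<bar>a b - real_of_rat r\<bar> < e / S" for b
    proof -
      have "a b - e / S < a b + e / S" using e S by (simp add: divide_pos_pos)
      then obtain r where "a b - e / S < real_of_rat r" "real_of_rat r < a b + e / S"
        using of_rat_dense by blast
      then show ?thesis by (intro exI[of _ r]) (simp add: abs_less_iff)
    qed
    then obtain q where q: "\<And>b. \<bar>a b - real_of_rat (q b)\<bar> < e / S" by metis
    define y where "y = (\<Sum>b\<in>B. real_of_rat (restrict q B b) *\<^sub>R b)"
    have "norm (x - y) \<le> (\<Sum>b\<in>B. (e / S) * norm b)"
      unfolding a y_def sum_subtractf[symmetric] scaleR_left_diff_distrib[symmetric]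
    proof (rule sum_norm_le)
      fix b assume "b \<in> B"
      then show "norm ((a b - real_of_rat (restrict q B b)) *\<^sub>R b) \<le> (e / S) * norm b"
        unfolding norm_scaleR using q[of b] by (intro mult_right_mono) auto
    qed
    also have "\<dots> = e * ((\<Sum>b\<in>B. norm b) / S)" by (simp add: sum_distrib_left sum_divide_distrib)
    also have "\<dots> < e * 1" using e S by (intro mult_strict_left_mono) simp_all
    finally have "norm (x - y) < e" by simp
    moreover have "y \<in> D" unfolding D_def y_def by (rule image_eqI[of _ _ "restrict q B"]) auto
    ultimately show ?thesis using from_nat_into_surj[OF D(1)] by blast
  qed
  ultimately show thesis using that[of "from_nat_into D"] from_nat_into[OF D(2)] by blast
qed

text \<open>
  The \<open>k\<close>-th coordinate is a functional that attains the norm at the \<open>k\<close>-th point of a dense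
  sequence. The sequence of these functionals is bounded on the span of \<open>B\<close> only, so \<open>T\<close> is defined on
  the basis and then extended linearly.
\<close>

lemma isometric_embedding_into_linf:
  fixes B :: "'a::real_normed_vector set"
  assumes B: "finite B" "independent B"
  obtains T :: "'a \<Rightarrow> nat \<Rightarrow>\<^sub>C real" where "linear T" "\<And>x. x \<in> span B \<Longrightarrow> norm (T x) = norm x"
proof -
  obtain s :: "nat \<Rightarrow> 'a" where s: "\<And>k. s k \<in> span B"
    "\<And>x e. x \<in> span B \<Longrightarrow> 0 < e \<Longrightarrow> \<exists>k. norm (x - s k) < e"
    using countable_dense_in_span[OF B(1)] by blast
  have "\<forall>k. \<exists>\<phi>. linear \<phi> \<and> \<phi> (s k) = norm (s k) \<and> (\<forall>x\<in>span (insert (s k) B). \<phi> x \<le> norm x)"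
    using norming_functional_exists[OF B(1)] by blast
  then obtain \<phi> where "\<forall>k. linear (\<phi> k) \<and> \<phi> k (s k) = norm (s k) \<and>
      (\<forall>x\<in>span (insert (s k) B). \<phi> k x \<le> norm x)"
    using choice[of "\<lambda>k \<phi>. linear \<phi> \<and> \<phi> (s k) = norm (s k) \<and> (\<forall>x\<in>span (insert (s k) B). \<phi> x \<le> norm x)"]
    by blast
  then have lin: "\<And>k. linear (\<phi> k)" and norming: "\<And>k. \<phi> k (s k) = norm (s k)"
    and dom: "\<And>k x. x \<in> span B \<Longrightarrow> \<phi> k x \<le> norm x"
    using s(1) by (auto simp: span_redundant)
  have abs: "\<bar>\<phi> k x\<bar> \<le> norm x" if x: "x \<in> span B" for k x
    using dom[OF x, of k] dom[OF span_neg[OF x], of k] linear_neg[OF lin, of k x]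
    by (simp add: abs_le_iff)
  have bcont: "(\<lambda>k. \<phi> k x) \<in> bcontfun" if "x \<in> span B" for x
    using abs[OF that] by (intro bcontfun_normI[of _ "norm x"]) (auto simp: continuous_on_discrete)
  obtain T :: "'a \<Rightarrow> nat \<Rightarrow>\<^sub>C real" where T: "linear T" "\<forall>b\<in>B. T b = Bcontfun (\<lambda>k. \<phi> k b)"
    using linear_independent_extend[OF B(2), of "\<lambda>b. Bcontfun (\<lambda>k. \<phi> k b)"] by blast
  have T_apply: "apply_bcontfun (T x) k = \<phi> k x" if x: "x \<in> span B" for x k
  proof -
    have "linear (\<lambda>x. apply_bcontfun (T x) k)"
      by (rule linearI) (simp_all add: linear_add[OF T(1)] linear_cmul[OF T(1)] plus_bcontfun.rep_eq scaleR_bcontfun.rep_eq)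
    from linear_eq_on_span[OF this lin _ x] show ?thesis
      using T(2) bcont[OF span_base] by (simp add: Bcontfun_inverse)
  qed
  have "norm (T x) = norm x" if x: "x \<in> span B" for x
  proof (rule antisym)
    show "norm (T x) \<le> norm x"
      by (rule norm_bound) (use T_apply[OF x] abs[OF x] in auto)
    show "norm x \<le> norm (T x)"
    proof (rule field_le_epsilon)
      fix e :: real assume "0 < e"
      then obtain k where k: "norm (x - s k) < e / 2" using s(2)[OF x, of "e / 2"] by auto
      have "norm x \<le> norm (s k) + norm (x - s k)" using norm_triangle_ineq[of "s k" "x - s k"] by simp
      moreover have "norm (s k) = \<phi> k x - \<phi> k (x - s k)" by (simp add: norming linear_diff[OF lin])
      moreover have "- \<phi> k (x - s k) \<le> norm (x - s k)"
        using abs[OF span_diff[OF x s(1)], of k k] by linarith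
      moreover have "\<phi> k x \<le> norm (T x)"
        using norm_bounded[of "T x" k] by (simp add: T_apply[OF x])
      ultimately show "norm x \<le> norm (T x) + e" using k by simp
    qed
  qed
  with T(1) show thesis using that by blast
qed

text \<open>
  The isometry carries a finite-dimensional subspace of \<open>X\<close> onto a Banach subspace of \<open>\<ell>\<^sub>\<infinity>\<close>, and an
  embedding into the latter can be pulled back.
\<close>

lemma embeds_with_distortion_transfer:
  fixes X :: "'a::real_normed_vector set"
  assumes linf: "\<And>Y. Y \<in> linf_subspaces \<Longrightarrow> dim_at_least Y r \<Longrightarrow> embeds_with_distortion V d Y K"
    and X: "X \<in> banach_subspaces" "dim_at_least X r"
  shows "embeds_with_distortion V d X K"
proof -
  obtain B where B: "B \<subseteq> X" "finite B" and indep: "independent B" and card: "r \<le> real (card B)"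
    using dim_at_least_finite[OF X(2)] by blast
  have span_X: "span B \<subseteq> X"
    using X(1) B(1) by (intro span_minimal) (auto simp: banach_subspaces_def)
  obtain T :: "'a \<Rightarrow> nat \<Rightarrow>\<^sub>C real" where T: "linear T" "\<And>x. x \<in> span B \<Longrightarrow> norm (T x) = norm x"
    using isometric_embedding_into_linf[OF B(2) indep] by blast
  have dist_T: "dist (T x) (T y) = dist x y" if "x \<in> span B" "y \<in> span B" for x y
    using T(2)[OF span_diff[OF that]] by (simp add: dist_norm linear_diff[OF T(1)])
  have inj: "inj_on T (span B)"
    by (rule inj_onI) (metis dist_T dist_eq_0_iff)
  have "independent (T ` B)" by (rule linear_independent_injective_image[OF T(1) indep inj])
  moreover have "card (T ` B) = card B"
    using card_image inj inj_on_subset span_superset by metis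
  ultimately have "dim_at_least (span (T ` B)) r"
    using card unfolding dim_at_least_def by (intro exI[of _ "T ` B"]) (simp add: span_superset)
  moreover have "span (T ` B) \<in> linf_subspaces"
    using B(2) by (simp add: linf_subspaces_def banach_subspaces_def complete_span_finite)
  ultimately obtain f where f: "inj_on f V" "f ` V \<subseteq> span (T ` B)" "distortion V d f \<le> ennreal K"
    using linf unfolding embeds_with_distortion_def by blast
  have range: "f x \<in> T ` span B" if "x \<in> V" for x
    using f(2) that linear_span_image[OF T(1)] by blast
  define g where "g x = inv_into (span B) T (f x)" for x
  have g: "g x \<in> span B" "T (g x) = f x" if "x \<in> V" for x
    using range[OF that] by (simp_all add: g_def inv_into_into f_inv_into_f)
  have dist_g: "dist (g x) (g y) = dist (f x) (f y)" if "x \<in> V" "y \<in> V" for x y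
    using dist_T[OF g(1)[OF that(1)] g(1)[OF that(2)]] g(2) that by simp
  have "distortion V d g = distortion V d f"
    unfolding distortion_def
    by (intro arg_cong2[of _ _ _ _ "(*)"] SUP_cong refl) (auto simp: dist_g)
  moreover have "inj_on g V"
    using f(1) g(2) by (metis inj_on_def)
  moreover have "g ` V \<subseteq> X" using g(1) span_X by blast
  ultimately show ?thesis using f(3) by (auto simp: embeds_with_distortion_def)
qed

lemma diamonds_embed_transfer:
  assumes "diamonds_embed \<epsilon> c C K linf_subspaces"
  shows "diamonds_embed \<epsilon> c C K (banach_subspaces :: 'a::real_normed_vector set set)"
  using assms embeds_with_distortion_transfer unfolding diamonds_embed_def by blast

section \<open>The theorem\<close>

theorem corollary3p4:
  fixes \<epsilon> :: real
  assumes "0 < \<epsilon>" and "\<epsilon> < 1 / 2"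
  shows "(\<exists>c>1. \<exists>C>1. \<exists>K. diamonds_embed \<epsilon> c C K linf_subspaces) \<and>
    (\<forall>c>1. \<forall>C>1. \<forall>K. diamonds_embed \<epsilon> c C K linf_subspaces \<longrightarrow>
      diamonds_embed \<epsilon> c C K (banach_subspaces :: 'a::real_normed_vector set set))"
proof (intro conjI allI impI)
  have w: "1 / 2 < 1 / 2 + \<epsilon>" "1 / 2 + \<epsilon> < 1" using assms by auto
  obtain A :: nat where A: "0 < A"
    "\<And>n Y. 0 < n \<Longrightarrow> subspace (Y :: (nat \<Rightarrow>\<^sub>C real) set) \<Longrightarrow> dim_at_least Y (A * n) \<Longrightarrow>
      embeds_with_distortion (pverts (weighted_diamond n)) (weighted_diamond_dist (1 / 2 + \<epsilon> - 1 / 2) n) Y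
        (64 / ((1 / 2 + \<epsilon> - 1 / 2) * (1 - (1 / 2 + \<epsilon>))))"
    using linear_dimension_suffices[OF w, where 'a = "nat \<Rightarrow>\<^sub>C real"] by blast
  define C where "C = max 2 (exp (max 1 (ln (A / ln 2))) / ln 2)"
  have "diamonds_embed \<epsilon> 2 C (64 / (\<epsilon> * (1 / 2 - \<epsilon>))) linf_subspaces"
    unfolding diamonds_embed_def
  proof (intro allI impI ballI)
    fix n Y
    let ?r = "exp (2 * (ln (ln (real (card (pverts (weighted_diamond n)))))) ^ 2)"
    assume n: "C \<le> real n" and Y: "Y \<in> linf_subspaces" "dim_at_least Y ?r"
    have "real (A * n) \<le> ?r"
      by (rule linear_le_exp_ln_ln_square[OF A(1) card_weighted_diamond_ge]) (use n in \<open>simp add: C_def\<close>)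
    then have "dim_at_least Y (A * n)" using Y(2) unfolding dim_at_least_def by (meson order_trans)
    moreover have "0 < n" using n by (simp add: C_def)
    moreover have "subspace Y" using Y(1) by (simp add: linf_subspaces_def banach_subspaces_def)
    ultimately show "embeds_with_distortion (pverts (weighted_diamond n)) (weighted_diamond_dist \<epsilon> n) Y
        (64 / (\<epsilon> * (1 / 2 - \<epsilon>)))"
      using A(2)[of n Y] by simp
  qed
  moreover have "1 < C" by (simp add: C_def)
  ultimately show "\<exists>c>1. \<exists>C>1. \<exists>K. diamonds_embed \<epsilon> c C K linf_subspaces"
    by (intro exI[of _ 2] exI[of _ C] conjI exI) auto
next
  fix c C K assume "diamonds_embed \<epsilon> c C K linf_subspaces"
  then show "diamonds_embed \<epsilon> c C K (banach_subspaces :: 'a set set)"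
    by (rule diamonds_embed_transfer)
qed

end
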